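(* Let $Q$ be a connected finite symmetric quiver. The minimal set of relations of the algebra $\mathcal A_Q$, considered as a (super)commutative algebra with generators $a_{i,k}$, forms a regular sequence if and only if $Q$ is one of the following quivers: (1) the quiver with one vertex and no loops; (2) the quiver with one vertex and one loop; (3) the quiver with two vertices $0$ and $1$ and exactly two arrows: one from $0$ to $1$ and the other from $1$ to $0$.
   Context: $Q$ has vertex set $Q_0$; $m_{i,j}$ is the number of arrows from $i$ to $j$; symmetric means $m_{i,j}=m_{j,i}$. Let $R$ be the free supercommutative $\mathbb{Q}$-algebra on generators $a_{i,k}$ ($i\in Q_0$, $k\ge 0$), where $a_{i,k}$ has degree $(\alpha_i,-2k-m_{i,i})\in\mathbb{Z}^{Q_0}\times\mathbb{Z}$ ($\alpha_i$ the standard basis) and parity $m_{i,i}$ mod 2; so $a_{i,k}a_{j,l}=(-1)^{m_{i,i}m_{j,j}}a_{j,l}a_{i,k}$. Then $\mathcal A_Q$ is the quotient of $R$ by the ideal generated by the quadratic elements $\sum_{k_1+k_2=k}\binom{k_2}{p}a_{i,k_1}a_{j,k_2}$ for all $i,j\in Q_0$, $k\ge0$, $0\le p<m_{i,j}$. The minimal set of relations means a homogeneous basis of the linear span of these quadratic elements in $R$ (arranged in a sequence). Regularity: for an $R$-module $M$, a homogeneous element $f\in R$ of even parity is $M$-regular if multiplication by $f$ is injective on $M$; a homogeneous $f$ of odd parity is $M$-regular if the kernel of $f$ on $M$ coincides with the image of $f$ on $M$. A (possibly infinite, possibly empty) sequence $f_1,f_2,\ldots$ is regular if each $f_i$ is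 regular on $R/(f_1,\ldots,f_{i-1})R$. *)

theory Defs
  imports
    Complex_Main
    "HOL-Library.Poly_Mapping"
    "HOL-Library.Product_Plus"
    "HOL-Library.Extended_Nat"
    "Graph_Theory.Digraph_Component"
    "HOL-Algebra.Module"
    "HOL-Algebra.QuotRing"
    "HOL-Algebra.Embedded_Algebras"
begin

section \<open>Quivers\<close>

text \<open>
  A quiver is a \<^typ>\<open>('v, 'e) pre_digraph\<close>: loops and multiple arrows are allowed. A finite quiver
  is a \<^const>\<open>fin_digraph\<close>. The library predicate \<open>symmetric\<close> ignores multiplicities and is therefore
  not used.
\<close>

definition num_arrows :: "('v, 'e) pre_digraph \<Rightarrow> 'v \<Rightarrow> 'v \<Rightarrow> nat" where
  "num_arrows Q i j = card {e \<in> arcs Q. tail Q e = i \<and> head Q e = j}"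

definition symmetric_quiver :: "('v, 'e) pre_digraph \<Rightarrow> bool" where
  "symmetric_quiver Q \<longleftrightarrow> (\<forall>i \<in> verts Q. \<forall>j \<in> verts Q. num_arrows Q i j = num_arrows Q j i)"


section \<open>Free associative and free supercommutative algebras over the rationals\<close>

text \<open>
  The type \<open>'g word \<Rightarrow>\<^sub>0 rat\<close> with its convolution product is the monoid algebra of the free monoid
  on \<open>'g\<close>, i.e. the free associative algebra; lists are wrapped because they are not an instance of
  \<^class>\<open>monoid_add\<close>.
\<close>

datatype 'g word = Word (letters: "'g list")

instantiation word :: (type) monoid_add
begin

definition zero_word :: "'a word" where "zero_word = Word []"

definition plus_word :: "'a word \<Rightarrow> 'a word \<Rightarrow> 'a word" where
  "plus_word u v = Word (letters u @ letters v)"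

instance
  by standard (simp_all add: zero_word_def plus_word_def)

end

definition free_algebra :: "'g set \<Rightarrow> ('g word \<Rightarrow>\<^sub>0 rat) ring" where
  "free_algebra X =
     \<lparr>carrier = {p. \<forall>w \<in> Poly_Mapping.keys p. set (letters w) \<subseteq> X},
      mult = (*), one = 1, zero = 0, add = (+)\<rparr>"

definition gen :: "'g \<Rightarrow> ('g word \<Rightarrow>\<^sub>0 rat)" where
  "gen x = Poly_Mapping.single (Word [x]) 1"

definition const :: "rat \<Rightarrow> ('g word \<Rightarrow>\<^sub>0 rat)" where
  "const c = Poly_Mapping.single 0 c"

text \<open>
  \<open>par x\<close> is any natural number representing the parity of the generator \<open>x\<close> modulo 2. For odd \<open>x\<close>
  the case \<open>x = y\<close> gives \<open>2 x\<^sup>2\<close>, so odd generators square to zero in the quotient.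
\<close>

definition supercommutators :: "'g set \<Rightarrow> ('g \<Rightarrow> nat) \<Rightarrow> ('g word \<Rightarrow>\<^sub>0 rat) set" where
  "supercommutators X par =
     {gen x * gen y - const ((-1) ^ (par x * par y)) * gen y * gen x | x y. x \<in> X \<and> y \<in> X}"

definition supercomm_ideal :: "'g set \<Rightarrow> ('g \<Rightarrow> nat) \<Rightarrow> ('g word \<Rightarrow>\<^sub>0 rat) set" where
  "supercomm_ideal X par = Idl\<^bsub>free_algebra X\<^esub> (supercommutators X par)"

definition free_supercomm_algebra ::
    "'g set \<Rightarrow> ('g \<Rightarrow> nat) \<Rightarrow> ('g word \<Rightarrow>\<^sub>0 rat) set ring" where
  "free_supercomm_algebra X par = free_algebra X Quot supercomm_ideal X par"


section \<open>The algebra of a quiver\<close>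

text \<open>The generator \<open>a\<^bsub>i,k\<^esub>\<close> is the pair \<open>(i, k)\<close>.\<close>

definition gens :: "('v, 'e) pre_digraph \<Rightarrow> ('v \<times> nat) set" where
  "gens Q = verts Q \<times> UNIV"

definition gen_par :: "('v, 'e) pre_digraph \<Rightarrow> 'v \<times> nat \<Rightarrow> nat" where
  "gen_par Q = (\<lambda>(i, k). num_arrows Q i i)"

definition gen_degree :: "('v, 'e) pre_digraph \<Rightarrow> 'v \<times> nat \<Rightarrow> ('v \<Rightarrow>\<^sub>0 int) \<times> int" where
  "gen_degree Q = (\<lambda>(i, k). (Poly_Mapping.single i 1, - 2 * int k - int (num_arrows Q i i)))"

definition word_par :: "('v, 'e) pre_digraph \<Rightarrow> ('v \<times> nat) word \<Rightarrow> nat" where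
  "word_par Q w = (\<Sum>x\<leftarrow>letters w. gen_par Q x) mod 2"

definition word_degree :: "('v, 'e) pre_digraph \<Rightarrow> ('v \<times> nat) word \<Rightarrow> ('v \<Rightarrow>\<^sub>0 int) \<times> int" where
  "word_degree Q w = (\<Sum>x\<leftarrow>letters w. gen_degree Q x)"

type_synonym 'v free_alg = "('v \<times> nat) word \<Rightarrow>\<^sub>0 rat"

abbreviation FA :: "('v, 'e) pre_digraph \<Rightarrow> 'v free_alg ring" where
  "FA Q \<equiv> free_algebra (gens Q)"

abbreviation R\<^sub>Q :: "('v, 'e) pre_digraph \<Rightarrow> 'v free_alg set ring" where
  "R\<^sub>Q Q \<equiv> free_supercomm_algebra (gens Q) (gen_par Q)"

text \<open>The class in \<open>R\<close> of an element of the free associative algebra.\<close>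

definition cls :: "('v, 'e) pre_digraph \<Rightarrow> 'v free_alg \<Rightarrow> 'v free_alg set" where
  "cls Q p = supercomm_ideal (gens Q) (gen_par Q) +>\<^bsub>FA Q\<^esub> p"

definition scalars :: "('v, 'e) pre_digraph \<Rightarrow> 'v free_alg set set" where
  "scalars Q = range (\<lambda>c. cls Q (const c))"

definition quad_relation ::
    "('v, 'e) pre_digraph \<Rightarrow> 'v \<Rightarrow> 'v \<Rightarrow> nat \<Rightarrow> nat \<Rightarrow> 'v free_alg set" where
  "quad_relation Q i j k p =
     cls Q (\<Sum>(k\<^sub>1, k\<^sub>2) \<in> {(k\<^sub>1, k\<^sub>2). k\<^sub>1 + k\<^sub>2 = k}.
              const (of_nat (k\<^sub>2 choose p)) * gen (i, k\<^sub>1) * gen (j, k\<^sub>2))"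

definition quad_relations :: "('v, 'e) pre_digraph \<Rightarrow> 'v free_alg set set" where
  "quad_relations Q =
     {quad_relation Q i j k p | i j k p. i \<in> verts Q \<and> j \<in> verts Q \<and> p < num_arrows Q i j}"

definition quiver_algebra :: "('v, 'e) pre_digraph \<Rightarrow> 'v free_alg set set ring" where
  "quiver_algebra Q = R\<^sub>Q Q Quot (Idl\<^bsub>R\<^sub>Q Q\<^esub> (quad_relations Q))"


section \<open>Homogeneous elements and the minimal set of relations\<close>

text \<open>The zero element has every degree and both parities.\<close>

definition has_degree ::
    "('v, 'e) pre_digraph \<Rightarrow> ('v \<Rightarrow>\<^sub>0 int) \<times> int \<Rightarrow> 'v free_alg set \<Rightarrow> bool" where
  "has_degree Q d f \<longleftrightarrow>
     (\<exists>p \<in> carrier (FA Q). f = cls Q p \<and> (\<forall>w \<in> Poly_Mapping.keys p. word_degree Q w = d))"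

definition has_parity :: "('v, 'e) pre_digraph \<Rightarrow> nat \<Rightarrow> 'v free_alg set \<Rightarrow> bool" where
  "has_parity Q \<epsilon> f \<longleftrightarrow>
     (\<exists>p \<in> carrier (FA Q). f = cls Q p \<and> (\<forall>w \<in> Poly_Mapping.keys p. word_par Q w = \<epsilon>))"

definition homogeneous :: "('v, 'e) pre_digraph \<Rightarrow> 'v free_alg set \<Rightarrow> bool" where
  "homogeneous Q f \<longleftrightarrow> (\<exists>d. has_degree Q d f)"

definition linear_span ::
    "('v, 'e) pre_digraph \<Rightarrow> 'v free_alg set set \<Rightarrow> 'v free_alg set set" where
  "linear_span Q S = (\<Union>us \<in> {us. set us \<subseteq> S}. ring.Span (R\<^sub>Q Q) (scalars Q) us)"

text \<open>
  A possibly infinite sequence is given by its length \<open>N :: enat\<close> and a function \<open>f\<close>, of which only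
  the values \<open>f n\<close> with \<open>enat n < N\<close> matter.
\<close>

definition minimal_relations ::
    "('v, 'e) pre_digraph \<Rightarrow> enat \<Rightarrow> (nat \<Rightarrow> 'v free_alg set) \<Rightarrow> bool" where
  "minimal_relations Q N f \<longleftrightarrow>
     (\<forall>n. enat n < N \<longrightarrow> homogeneous Q (f n)) \<and>
     (\<forall>n. enat n \<le> N \<longrightarrow> ring.independent (R\<^sub>Q Q) (scalars Q) (map f [0..<n])) \<and>
     linear_span Q (f ` {n. enat n < N}) = linear_span Q (quad_relations Q)"


section \<open>Regular sequences\<close>

definition quotient_module ::
    "('a, 'm) ring_scheme \<Rightarrow> 'a set \<Rightarrow> ('a, 'a set) module" where
  "quotient_module R I =
     \<lparr>carrier = carrier (R Quot I), mult = mult (R Quot I), one = one (R Quot I),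
      zero = zero (R Quot I), add = add (R Quot I),
      smult = (\<lambda>r x. (I +>\<^bsub>R\<^esub> r) \<otimes>\<^bsub>R Quot I\<^esub> x)\<rparr>"

text \<open>
  Only the additive group and the scalar action of \<open>M\<close> enter. For \<open>f = 0\<close>, which is both even and
  odd, either condition says that \<open>M\<close> is zero.
\<close>

definition regular_on ::
    "('v, 'e) pre_digraph \<Rightarrow> ('v free_alg set, 'b) module \<Rightarrow> 'v free_alg set \<Rightarrow> bool" where
  "regular_on Q M f \<longleftrightarrow> homogeneous Q f \<and>
     (has_parity Q 0 f \<longrightarrow> inj_on (\<lambda>x. f \<odot>\<^bsub>M\<^esub> x) (carrier M)) \<and>
     (has_parity Q 1 f \<longrightarrow> a_kernel M M (\<lambda>x. f \<odot>\<^bsub>M\<^esub> x) = (\<lambda>x. f \<odot>\<^bsub>M\<^esub> x) ` carrier M)"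

text \<open>
  For homogeneous elements of a supercommutative ring the one-sided and the two-sided ideals they
  generate coincide, so \<open>(f\<^sub>0, \<dots>, f\<^bsub>n-1\<^esub>)R\<close> is the two-sided ideal \<open>Idl\<close>.
\<close>

definition regular_sequence ::
    "('v, 'e) pre_digraph \<Rightarrow> enat \<Rightarrow> (nat \<Rightarrow> 'v free_alg set) \<Rightarrow> bool" where
  "regular_sequence Q N f \<longleftrightarrow>
     (\<forall>n. enat n < N \<longrightarrow>
        regular_on Q (quotient_module (R\<^sub>Q Q) (Idl\<^bsub>R\<^sub>Q Q\<^esub> (f ` {..<n}))) (f n))"


section \<open>Consistency checks\<close>

lemma carrier_free_algebra_iff:
  "p \<in> carrier (free_algebra X) \<longleftrightarrow> (\<forall>w \<in> Poly_Mapping.keys p. set (letters w) \<subseteq> X)"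
  by (simp add: free_algebra_def)

lemma gen_closed: "x \<in> X \<Longrightarrow> gen x \<in> carrier (free_algebra X)"
  by (simp add: carrier_free_algebra_iff gen_def)

lemma const_closed: "const c \<in> carrier (free_algebra X)"
  by (simp add: carrier_free_algebra_iff const_def zero_word_def)

lemma add_closed:
  "p \<in> carrier (free_algebra X) \<Longrightarrow> q \<in> carrier (free_algebra X) \<Longrightarrow>
     p + q \<in> carrier (free_algebra X)"
  using Poly_Mapping.keys_add[of p q] by (fastforce simp: carrier_free_algebra_iff)

lemma uminus_closed:
  "p \<in> carrier (free_algebra X) \<Longrightarrow> - p \<in> carrier (free_algebra X)"
  by (simp add: carrier_free_algebra_iff)

lemma mult_closed:
  "p \<in> carrier (free_algebra X) \<Longrightarrow> q \<in> carrier (free_algebra X) \<Longrightarrow>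
     p * q \<in> carrier (free_algebra X)"
  using Poly_Mapping.keys_mult[of p q]
  by (fastforce simp: carrier_free_algebra_iff plus_word_def)

lemma free_algebra_ops:
  "mult (free_algebra X) = (*)" "one (free_algebra X) = 1"
  "zero (free_algebra X) = 0" "add (free_algebra X) = (+)"
  by (simp_all add: free_algebra_def)

lemma zero_closed: "0 \<in> carrier (free_algebra X)"
  by (simp add: carrier_free_algebra_iff)

lemma one_closed: "1 \<in> carrier (free_algebra X)"
  using const_closed[of 1] by (simp add: const_def)

lemma ring_free_algebra: "ring (free_algebra X)"
proof (rule ringI)
  show "abelian_group (free_algebra X)"
  proof (rule abelian_groupI)
    fix p assume "p \<in> carrier (free_algebra X)"
    then show "\<exists>q \<in> carrier (free_algebra X). q \<oplus>\<^bsub>free_algebra X\<^esub> p = \<zero>\<^bsub>free_algebra X\<^esub>"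
      using uminus_closed by (intro bexI[of _ "- p"]) (auto simp: free_algebra_ops)
  qed (simp_all add: free_algebra_ops add_closed zero_closed algebra_simps)
  show "monoid (free_algebra X)"
    by (rule monoidI) (simp_all add: free_algebra_ops mult_closed one_closed algebra_simps)
qed (simp_all add: free_algebra_ops algebra_simps)

lemma supercommutators_closed: "supercommutators X par \<subseteq> carrier (free_algebra X)"
proof
  fix p assume "p \<in> supercommutators X par"
  then obtain x y where xy: "x \<in> X" "y \<in> X"
    and p: "p = gen x * gen y + - (const ((-1) ^ (par x * par y)) * gen y * gen x)"
    by (auto simp: supercommutators_def)
  show "p \<in> carrier (free_algebra X)"
    unfolding p using xy by (intro add_closed uminus_closed mult_closed gen_closed const_closed)
qed

lemma ideal_supercomm_ideal: "ideal (supercomm_ideal X par) (free_algebra X)"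
  unfolding supercomm_ideal_def
  by (rule ring.genideal_ideal[OF ring_free_algebra supercommutators_closed])

lemma ring_free_supercomm_algebra: "ring (free_supercomm_algebra X par)"
  unfolding free_supercomm_algebra_def by (rule ideal.quotient_is_ring[OF ideal_supercomm_ideal])

lemma cls_eq_iff:
  assumes "p \<in> carrier (FA Q)" "q \<in> carrier (FA Q)"
  shows "cls Q p = cls Q q \<longleftrightarrow> p - q \<in> supercomm_ideal (gens Q) (gen_par Q)"
proof -
  have minus: "p \<ominus>\<^bsub>FA Q\<^esub> q = p - q"
  proof -
    interpret ring "FA Q" by (rule ring_free_algebra)
    have "\<ominus>\<^bsub>FA Q\<^esub> q = - q"
      by (rule minus_equality) (use assms uminus_closed in \<open>auto simp: free_algebra_ops\<close>)
    then show ?thesis by (simp add: a_minus_def free_algebra_ops)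
  qed
  show ?thesis
    unfolding cls_def minus[symmetric]
    by (rule ring.quotient_eq_iff_same_a_r_cos[OF ring_free_algebra ideal_supercomm_ideal, symmetric])
       (use assms in auto)
qed

lemma cls_mult:
  assumes "p \<in> carrier (FA Q)" "q \<in> carrier (FA Q)"
  shows "cls Q p \<otimes>\<^bsub>R\<^sub>Q Q\<^esub> cls Q q = cls Q (p * q)"
  using ideal.rcoset_mult_add[OF ideal_supercomm_ideal assms]
  by (simp add: cls_def free_supercomm_algebra_def FactRing_def free_algebra_ops)

lemma gens_supercommute:
  assumes "i \<in> verts Q" "j \<in> verts Q"
  shows "cls Q (gen (i, k)) \<otimes>\<^bsub>R\<^sub>Q Q\<^esub> cls Q (gen (j, l)) =
         cls Q (const ((-1) ^ (num_arrows Q i i * num_arrows Q j j))) \<otimes>\<^bsub>R\<^sub>Q Q\<^esub>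
           (cls Q (gen (j, l)) \<otimes>\<^bsub>R\<^sub>Q Q\<^esub> cls Q (gen (i, k)))"
proof -
  let ?c = "const ((-1) ^ (num_arrows Q i i * num_arrows Q j j)) :: _ free_alg"
  have g: "(i, k) \<in> gens Q" "(j, l) \<in> gens Q" using assms by (auto simp: gens_def)
  note cl = gen_closed[OF g(1)] gen_closed[OF g(2)] const_closed mult_closed
  have "gen (i, k) * gen (j, l) - ?c * (gen (j, l) * gen (i, k))
          \<in> supercommutators (gens Q) (gen_par Q)"
    unfolding supercommutators_def using g by (force simp: gen_par_def mult.assoc)
  also have "\<dots> \<subseteq> supercomm_ideal (gens Q) (gen_par Q)"
    unfolding supercomm_ideal_def
    by (rule ring.genideal_self[OF ring_free_algebra supercommutators_closed])
  finally show ?thesis by (simp add: cls_mult cl cls_eq_iff)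
qed

end

theory Submission
  imports Defs
begin

text \<open>
  Necessity: modulo the first relations, an element of word length one vanishes as soon as it lies in
  the ideal of the relations, which starts in length two. Hence a regular sequence of quadratic
  relations admits no non-trivial linear syzygy, and neither does any other basis of their span. Each
  remaining connected quiver has a linear syzygy, for instance
  \<open>(a\<^bsub>i,0\<^esub> a\<^bsub>j,0\<^esub>) a\<^bsub>j,1\<^esub> = (a\<^bsub>i,0\<^esub> a\<^bsub>j,1\<^esub>) a\<^bsub>j,0\<^esub>\<close> when \<open>m\<^bsub>i,j\<^esub> \<ge> 2\<close> and \<open>a\<^bsub>j,k\<^esub>\<close> is even,
  \<open>(a\<^bsub>i,0\<^esub> a\<^bsub>j,0\<^esub>) a\<^bsub>j,0\<^esub> = 0\<close> when \<open>a\<^bsub>j,k\<^esub>\<close> is odd, and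
  \<open>(a\<^bsub>i,0\<^esub> a\<^bsub>j,0\<^esub>) a\<^bsub>k,0\<^esub> = (a\<^bsub>k,0\<^esub> a\<^bsub>j,0\<^esub>) a\<^bsub>i,0\<^esub>\<close> on a path of length two.

  Sufficiency: for one vertex all relations vanish. For two vertices they are, up to scalars and order,
  the coefficients \<open>F\<^sub>k\<close> of \<open>a(t) b(t)\<close> in a polynomial ring. Any list of distinct \<open>F\<^sub>k\<close> is regular, by
  induction on the indices: modulo \<open>a\<^sub>0\<close> (or \<open>b\<^sub>0\<close>) the series \<open>a\<close> (or \<open>b\<close>) is divisible by \<open>t\<close>, so
  all indices drop by one; \<open>F\<^sub>0 = a\<^sub>0 b\<^sub>0\<close> is handled by multiplicativity of regularity in one entry, and
  otherwise \<open>a\<^sub>0\<close> is moved to the end of the regular list, which grading allows, and dropped.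
\<close>

subsection \<open>The ideal of supercommutators\<close>

lemma diff_closed:
  "p \<in> carrier (free_algebra X) \<Longrightarrow> q \<in> carrier (free_algebra X) \<Longrightarrow> p - q \<in> carrier (free_algebra X)"
  using add_closed[of p X "- q"] uminus_closed[of q X] by simp

lemma sum_closed:
  "(\<And>i. i \<in> A \<Longrightarrow> p i \<in> carrier (free_algebra X)) \<Longrightarrow> sum p A \<in> carrier (free_algebra X)"
  by (induction A rule: infinite_finite_induct) (auto intro: add_closed zero_closed)

lemma lookup_const_mult [simp]:
  "Poly_Mapping.lookup (const c * p) w = c * Poly_Mapping.lookup p w"
  unfolding const_def mult_map_scale_conv_mult[symmetric]
  by (simp add: Poly_Mapping.map.rep_eq when_def)

lemma const_mult: "const (c * d) = const c * const d"
  by (simp add: const_def mult_single)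

lemma const_add: "const (c + d) = const c + const d"
  by (simp add: const_def single_add)

lemma const_0 [simp]: "const 0 = 0" and const_1 [simp]: "const 1 = 1"
  by (simp_all add: const_def)

lemma const_uminus: "const (- c) = - const c"
  by (simp add: const_def single_uminus)

lemma poly_mapping_single_induct [case_names zero add]:
  assumes "P 0" "\<And>k v p. P p \<Longrightarrow> P (Poly_Mapping.single k v + p)"
  shows "P p"
proof (induction p rule: Poly_Mapping.update_induct)
  case (update f a b)
  have "Poly_Mapping.update a b f = Poly_Mapping.single a b + f"
    using update.hyps
    by (intro poly_mapping_eqI)
       (auto simp: lookup_update lookup_add lookup_single when_def in_keys_iff)
  with assms(2) update.IH show ?case by simp
qed (rule assms(1))

lemma mult_const: "p * const c = const c * p"
  by (induction p rule: poly_mapping_single_induct)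
     (auto simp: algebra_simps const_def mult_single)

text \<open>The rationals act through products with constant polynomials. Spans and subspaces thus
  become available in the free algebra, and every ideal is a subspace for this action.\<close>

interpretation vs: vector_space "\<lambda>c p. const c * p :: 'g word \<Rightarrow>\<^sub>0 rat"
  by unfold_locales (simp_all add: algebra_simps const_mult const_add)

declare vs.scale_scale [simp del]

lemma subspace_carrier: "vs.subspace (carrier (free_algebra X))"
  by (intro vs.subspaceI zero_closed add_closed mult_closed const_closed)

lemma span_carrier: "G \<subseteq> carrier (free_algebra X) \<Longrightarrow> vs.span G \<subseteq> carrier (free_algebra X)"
  using vs.span_minimal subspace_carrier by blast

text \<open>Additive inverses come for free: \<open>- p\<close> is the product of
  \<open>const (- 1)\<close> and \<open>p\<close>, so closure under multiplication covers
  them.\<close>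

lemma idealI_free_algebra:
  assumes "J \<subseteq> carrier (free_algebra X)" "0 \<in> J"
    and "\<And>p q. p \<in> J \<Longrightarrow> q \<in> J \<Longrightarrow> p + q \<in> J"
    and "\<And>p q. p \<in> J \<Longrightarrow> q \<in> carrier (free_algebra X) \<Longrightarrow> q * p \<in> J"
    and "\<And>p q. p \<in> J \<Longrightarrow> q \<in> carrier (free_algebra X) \<Longrightarrow> p * q \<in> J"
  shows "ideal J (free_algebra X)"
proof (rule idealI[OF ring_free_algebra])
  interpret ring "free_algebra X" by (rule ring_free_algebra)
  have minus: "\<ominus>\<^bsub>free_algebra X\<^esub> p = - p" if "p \<in> carrier (free_algebra X)" for p
    by (rule minus_equality) (use that uminus_closed in \<open>auto simp: free_algebra_ops\<close>)
  show "subgroup J (add_monoid (free_algebra X))"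
  proof (rule add.subgroupI)
    fix p assume p: "p \<in> J"
    then have "- p = const (- 1) * p" by (simp add: const_uminus)
    also have "\<dots> \<in> J" using assms(4)[OF p const_closed] .
    finally show "\<ominus>\<^bsub>free_algebra X\<^esub> p \<in> J" using p assms(1) minus by auto
  qed (use assms in \<open>auto simp: free_algebra_ops\<close>)
qed (use assms in \<open>auto simp: free_algebra_ops\<close>)

context
  fixes X :: "'g set" and par :: "'g \<Rightarrow> nat"
begin

interpretation sc: ideal "supercomm_ideal X par" "free_algebra X"
  by (rule ideal_supercomm_ideal)

lemma supercomm_ideal_carrier: "p \<in> supercomm_ideal X par \<Longrightarrow> p \<in> carrier (free_algebra X)"
  using sc.Icarr .

lemma supercomm_ideal_zero: "0 \<in> supercomm_ideal X par"
  using additive_subgroup.zero_closed[OF sc.is_additive_subgroup] by (simp add: free_algebra_ops)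

lemma supercomm_ideal_add:
  "p \<in> supercomm_ideal X par \<Longrightarrow> q \<in> supercomm_ideal X par \<Longrightarrow> p + q \<in> supercomm_ideal X par"
  using additive_subgroup.a_closed[OF sc.is_additive_subgroup] by (simp add: free_algebra_ops)

lemma supercomm_ideal_mult:
  assumes "p \<in> supercomm_ideal X par" "q \<in> carrier (free_algebra X)"
  shows supercomm_ideal_mult_left: "q * p \<in> supercomm_ideal X par"
    and supercomm_ideal_mult_right: "p * q \<in> supercomm_ideal X par"
  using sc.I_l_closed[OF assms] sc.I_r_closed[OF assms] by (simp_all add: free_algebra_ops)

lemma subspace_supercomm_ideal: "vs.subspace (supercomm_ideal X par)"
  by (intro vs.subspaceI supercomm_ideal_zero supercomm_ideal_add supercomm_ideal_mult_left const_closed)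

lemmas supercomm_ideal_diff = vs.subspace_diff[OF subspace_supercomm_ideal]
  and supercomm_ideal_sum = vs.subspace_sum[OF subspace_supercomm_ideal]
  and supercomm_ideal_scale = vs.subspace_scale[OF subspace_supercomm_ideal]

lemma supercommutator_in:
  "x \<in> X \<Longrightarrow> y \<in> X \<Longrightarrow>
    gen x * gen y - const ((-1) ^ (par x * par y)) * gen y * gen x \<in> supercomm_ideal X par"
  using ring.genideal_self[OF ring_free_algebra supercommutators_closed, of X par]
  unfolding supercomm_ideal_def supercommutators_def by blast

lemma even_commute_in:
  assumes "x \<in> X" "y \<in> X" "even (par x * par y)"
  shows "gen x * gen y - gen y * gen x \<in> supercomm_ideal X par"
  using supercommutator_in[OF assms(1,2)] assms(3) by simp

text \<open>The supercommutator of an odd \<open>x\<close> with itself is twice its square, and 2 is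
  invertible among the rational scalars.\<close>

lemma odd_square_in:
  assumes "x \<in> X" "odd (par x)"
  shows "gen x * gen x \<in> supercomm_ideal X par"
proof -
  have "gen x * gen x + gen x * gen x \<in> supercomm_ideal X par"
    using supercommutator_in[OF assms(1,1)] assms(2) by (simp add: const_uminus)
  moreover have "const (1/2) * (p + p) = p" for p :: "'g word \<Rightarrow>\<^sub>0 rat"
    by (simp add: distrib_left flip: vs.scale_left_distrib)
  ultimately show ?thesis using supercomm_ideal_scale by metis
qed

text \<open>In word length two the ideal consists of the combinations of supercommutators, on which the
  linear functional below vanishes.\<close>

lemma supercomm_ideal_quadratic:
  assumes "p \<in> supercomm_ideal X par"
  shows "\<forall>w \<in> Poly_Mapping.keys p. 2 \<le> length (letters w)"
    and "Poly_Mapping.lookup p (Word [x, y])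
      + (-1) ^ (par x * par y) * Poly_Mapping.lookup p (Word [y, x]) = 0"
proof -
  \<comment> \<open>Once \<open>J\<close> is an ideal containing the supercommutators, it contains
    the ideal they generate.\<close>
  define J where "J = {p \<in> carrier (free_algebra X).
    (\<forall>w \<in> Poly_Mapping.keys p. 2 \<le> length (letters w)) \<and>
    (\<forall>x y. Poly_Mapping.lookup p (Word [x, y])
      + (-1) ^ (par x * par y) * Poly_Mapping.lookup p (Word [y, x]) = 0)}"
  have len_add: "2 \<le> length (letters w)" if "w \<in> Poly_Mapping.keys (p * q)"
    "(\<forall>w \<in> Poly_Mapping.keys p. 2 \<le> length (letters w)) \<or> (\<forall>w \<in> Poly_Mapping.keys q. 2 \<le> length (letters w))"
    for w and p q :: "'g word \<Rightarrow>\<^sub>0 rat"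
    using keys_mult[of p q] that by (fastforce simp: plus_word_def)
  \<comment> \<open>A factor \<open>q\<close> acts on the coefficients of length two only through
    its constant term, because the other factor starts in length two; hence the constant term is
    split off.\<close>
  have split: "\<exists>c q'. q = const c + q' \<and> Word [] \<notin> Poly_Mapping.keys q'" for q :: "'g word \<Rightarrow>\<^sub>0 rat"
  proof (intro exI conjI)
    show "q = const (Poly_Mapping.lookup q (Word [])) + (q - const (Poly_Mapping.lookup q (Word [])))"
      by simp
    show "Word [] \<notin> Poly_Mapping.keys (q - const (Poly_Mapping.lookup q (Word [])))"
      by (simp add: in_keys_iff lookup_minus const_def lookup_single zero_word_def)
  qed
  have len3: "Poly_Mapping.lookup (p * q) (Word [x, y]) = 0"
    if "(\<forall>w \<in> Poly_Mapping.keys p. 2 \<le> length (letters w)) \<and> Word [] \<notin> Poly_Mapping.keys q \<or>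
        (\<forall>w \<in> Poly_Mapping.keys q. 2 \<le> length (letters w)) \<and> Word [] \<notin> Poly_Mapping.keys p"
    for p q :: "'g word \<Rightarrow>\<^sub>0 rat" and x y
  proof (rule ccontr)
    assume "Poly_Mapping.lookup (p * q) (Word [x, y]) \<noteq> 0"
    then have "Word [x, y] \<in> Poly_Mapping.keys (p * q)" by (simp add: in_keys_iff)
    then obtain u v where uv: "u \<in> Poly_Mapping.keys p" "v \<in> Poly_Mapping.keys q" "Word [x, y] = u + v"
      using keys_mult[of p q] by blast
    then have "[x, y] = letters u @ letters v" by (simp add: plus_word_def)
    from arg_cong[OF this, of length] have len: "length (letters u) + length (letters v) = 2" by simp
    have ne: "0 < length (letters w)" if "w \<noteq> Word []" for w :: "'g word"
      using that by (cases w) simp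
    have "2 \<le> length (letters u) \<and> v \<noteq> Word [] \<or> 2 \<le> length (letters v) \<and> u \<noteq> Word []"
      using that uv(1,2) by blast
    then show False using ne[of u] ne[of v] len by arith
  qed
  have "ideal J (free_algebra X)"
  proof (rule idealI_free_algebra)
    fix p q assume p: "p \<in> J" and q: "q \<in> carrier (free_algebra X)"
    obtain c q' where q': "q = const c + q'" "Word [] \<notin> Poly_Mapping.keys q'" using split by blast
    have "Poly_Mapping.lookup (q * p) (Word [x, y]) = c * Poly_Mapping.lookup p (Word [x, y])"
      "Poly_Mapping.lookup (p * q) (Word [x, y]) = c * Poly_Mapping.lookup p (Word [x, y])" for x y
      using len3[of q' p] len3[of p q'] p q'(2)
      by (auto simp: q'(1) J_def distrib_left distrib_right lookup_add mult_const)
    moreover have "c * a + s * (c * b) = c * (a + s * b)" for a b s :: rat by (simp add: algebra_simps)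
    ultimately show "q * p \<in> J" "p * q \<in> J"
      using p q len_add[of _ q p] len_add[of _ p q] by (auto simp: J_def mult_closed)
  next
    fix p q assume pq: "p \<in> J" "q \<in> J"
    then have "2 \<le> length (letters w)" if "w \<in> Poly_Mapping.keys (p + q)" for w
      using Poly_Mapping.keys_add[of p q] that by (auto simp: J_def)
    moreover have "Poly_Mapping.lookup (p + q) (Word [x, y])
        + (-1) ^ (par x * par y) * Poly_Mapping.lookup (p + q) (Word [y, x]) =
      (Poly_Mapping.lookup p (Word [x, y]) + (-1) ^ (par x * par y) * Poly_Mapping.lookup p (Word [y, x])) +
      (Poly_Mapping.lookup q (Word [x, y]) + (-1) ^ (par x * par y) * Poly_Mapping.lookup q (Word [y, x]))" for x y
      by (simp add: lookup_add algebra_simps)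
    ultimately show "p + q \<in> J" using pq by (simp add: J_def add_closed)
  qed (auto simp: J_def zero_closed)
  moreover have "supercommutators X par \<subseteq> J"
  proof
    fix p assume p: "p \<in> supercommutators X par"
    then obtain x y where xy: "p = gen x * gen y - const ((-1) ^ (par x * par y)) * gen y * gen x"
      by (auto simp: supercommutators_def)
    let ?s = "(-1) ^ (par x * par y) :: rat"
    have eq: "p = Poly_Mapping.single (Word [x, y]) 1 - Poly_Mapping.single (Word [y, x]) ?s"
      by (simp add: xy gen_def const_def mult_single plus_word_def zero_word_def)
    have "2 \<le> length (letters w)" if "w \<in> Poly_Mapping.keys p" for w
      using that by (auto simp: eq in_keys_iff lookup_minus lookup_single when_def split: if_splits)
    moreover have "Poly_Mapping.lookup p (Word [u, v])
        + (-1) ^ (par u * par v) * Poly_Mapping.lookup p (Word [v, u]) = 0" for u v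
    proof -
      \<comment> \<open>The sign \<open>s\<close> is symmetric in \<open>x\<close> and
        \<open>y\<close> and squares to one. This makes the functional vanish for both orders of the
        letters, also when \<open>x = y\<close>, where the element is \<open>1 - s\<close> times a
        square.\<close>
      define s where "s = ?s"
      have s: "s * s = 1" "(-1) ^ (par y * par x) = s" "?s = s"
        by (simp_all add: s_def mult.commute[of "par y" "par x"] flip: power_add)
      have lookup_p: "Poly_Mapping.lookup p (Word [a, b])
          = (if a = x \<and> b = y then 1 else 0) - (if a = y \<and> b = x then s else 0)" for a b
        unfolding eq s(3) lookup_minus lookup_single when_def word.inject list.inject
        by (simp only: eq_commute[of x] eq_commute[of y] simp_thms)
      consider "u = x" "v = y" | "u = y" "v = x" | "\<not> (u = x \<and> v = y)" "\<not> (u = y \<and> v = x)" by blast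
      then show ?thesis
      proof cases
        case 1
        show ?thesis unfolding 1 s lookup_p by (cases "x = y") (simp_all add: right_diff_distrib s(1))
      next
        case 2
        show ?thesis unfolding 2 s lookup_p by (cases "x = y") (simp_all add: right_diff_distrib s(1))
      next
        case 3
        then have "(u = x \<and> v = y) = False" "(u = y \<and> v = x) = False"
          "(v = x \<and> u = y) = False" "(v = y \<and> u = x) = False" by blast+
        then show ?thesis unfolding lookup_p by (simp only: if_False diff_self mult_zero_right add_0)
      qed
    qed
    ultimately show "p \<in> J" using subsetD[OF supercommutators_closed p] by (simp add: J_def)
  qed
  ultimately have "p \<in> J"
    using assms ring.genideal_minimal[OF ring_free_algebra] unfolding supercomm_ideal_def by blast
  then show "\<forall>w \<in> Poly_Mapping.keys p. 2 \<le> length (letters w)"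
    and "Poly_Mapping.lookup p (Word [x, y])
      + (-1) ^ (par x * par y) * Poly_Mapping.lookup p (Word [y, x]) = 0"
    by (auto simp: J_def)
qed

end

subsection \<open>Classes\<close>

context
  fixes Q :: "('v, 'e) pre_digraph"
begin

abbreviation (input) "IQ \<equiv> supercomm_ideal (gens Q) (gen_par Q)"

interpretation RQ: ring "R\<^sub>Q Q" by (rule ring_free_supercomm_algebra)
interpretation sc: ideal IQ "FA Q" by (rule ideal_supercomm_ideal)

lemma carrier_RQ: "carrier (R\<^sub>Q Q) = cls Q ` carrier (FA Q)"
  by (auto simp: free_supercomm_algebra_def FactRing_def A_RCOSETS_def' cls_def)

lemma cls_in: "p \<in> carrier (FA Q) \<Longrightarrow> cls Q p \<in> carrier (R\<^sub>Q Q)"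
  by (simp add: carrier_RQ)

lemma cls_add:
  assumes "p \<in> carrier (FA Q)" "q \<in> carrier (FA Q)"
  shows "cls Q p \<oplus>\<^bsub>R\<^sub>Q Q\<^esub> cls Q q = cls Q (p + q)"
  using sc.a_rcos_sum[OF assms]
  by (simp add: cls_def free_supercomm_algebra_def FactRing_def free_algebra_ops)

lemma cls_zero: "\<zero>\<^bsub>R\<^sub>Q Q\<^esub> = cls Q 0"
  using sc.a_coset_add_zero[of IQ] sc.a_subset
  by (simp add: cls_def free_supercomm_algebra_def FactRing_def free_algebra_ops)

lemma cls_minus:
  assumes "p \<in> carrier (FA Q)" "q \<in> carrier (FA Q)"
  shows "cls Q p \<ominus>\<^bsub>R\<^sub>Q Q\<^esub> cls Q q = cls Q (p - q)"
proof -
  have "\<ominus>\<^bsub>R\<^sub>Q Q\<^esub> cls Q q = cls Q (- q)"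
    by (rule RQ.minus_equality)
       (use assms in \<open>auto simp: cls_in cls_add cls_zero uminus_closed\<close>)
  then show ?thesis using assms by (simp add: a_minus_def cls_add uminus_closed)
qed

lemma cls_eq_zero_iff: "p \<in> carrier (FA Q) \<Longrightarrow> cls Q p = \<zero>\<^bsub>R\<^sub>Q Q\<^esub> \<longleftrightarrow> p \<in> IQ"
  by (simp add: cls_zero cls_eq_iff zero_closed)

text \<open>The recursive \<open>Span\<close> in the quotient ring is transported to the linear span
  of representatives, one \<open>line_extension\<close> for each \<open>vs.span_insert\<close>.
  Linear algebra can then be done in the free algebra.\<close>

lemma Span_cls:
  assumes "set ps \<subseteq> carrier (FA Q)"
  shows "ring.Span (R\<^sub>Q Q) (scalars Q) (map (cls Q) ps) = cls Q ` vs.span (set ps)"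
  using assms
proof (induction ps)
  case Nil
  then show ?case by (simp add: cls_zero)
next
  case (Cons p ps)
  have sp: "vs.span (set ps) \<subseteq> carrier (FA Q)" using Cons.prems span_carrier by auto
  have "ring.Span (R\<^sub>Q Q) (scalars Q) (map (cls Q) (p # ps))
    = {cls Q (const c) \<otimes>\<^bsub>R\<^sub>Q Q\<^esub> cls Q p \<oplus>\<^bsub>R\<^sub>Q Q\<^esub> cls Q q | c q. q \<in> vs.span (set ps)}"
    using Cons by (auto simp: RQ.line_extension_def set_add_def' r_coset_def scalars_def)
  also have "\<dots> = {cls Q (const c * p + q) | c q. q \<in> vs.span (set ps)}"
  proof -
    have "cls Q (const c) \<otimes>\<^bsub>R\<^sub>Q Q\<^esub> cls Q p \<oplus>\<^bsub>R\<^sub>Q Q\<^esub> cls Q q = cls Q (const c * p + q)"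
      if "q \<in> vs.span (set ps)" for c q
    proof -
      have "q \<in> carrier (FA Q)" "p \<in> carrier (FA Q)" using that sp Cons.prems by auto
      then show ?thesis by (simp add: cls_mult cls_add const_closed mult_closed)
    qed
    then show ?thesis by (metis (no_types, lifting))
  qed
  also have "\<dots> = cls Q ` vs.span (insert p (set ps))"
  proof -
    have "const c * p + q \<in> vs.span (insert p (set ps))" if "q \<in> vs.span (set ps)" for c q
      using that by (auto simp: vs.span_insert intro!: exI[of _ c])
    moreover have "\<exists>c q. x = const c * p + q \<and> q \<in> vs.span (set ps)"
      if "x \<in> vs.span (insert p (set ps))" for x
      using that by (auto simp: vs.span_insert) (metis add.commute diff_add_cancel)
    ultimately show ?thesis by auto blast
  qed
  finally show ?case by simp
qed

text \<open>A vector of a span needs only finitely many generators, so \<open>Span_cls\<close> for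
  finite lists settles arbitrary sets.\<close>

lemma linear_span_cls:
  assumes "G \<subseteq> carrier (FA Q)"
  shows "linear_span Q (cls Q ` G) = cls Q ` vs.span G"
proof (intro equalityI subsetI)
  fix x assume "x \<in> linear_span Q (cls Q ` G)"
  then obtain us where us: "set us \<subseteq> cls Q ` G" "x \<in> ring.Span (R\<^sub>Q Q) (scalars Q) us"
    by (auto simp: linear_span_def)
  define ps where "ps = map (inv_into G (cls Q)) us"
  have ps: "us = map (cls Q) ps" "set ps \<subseteq> G"
  proof -
    have "map (cls Q) ps = us"
      unfolding ps_def map_map by (rule map_idI) (use us(1) in \<open>auto simp: f_inv_into_f\<close>)
    then show "us = map (cls Q) ps" ..
    show "set ps \<subseteq> G" using us(1) by (auto simp: ps_def intro!: inv_into_into)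
  qed
  have "x \<in> cls Q ` vs.span (set ps)" using us(2) unfolding ps(1) Span_cls[OF order_trans[OF ps(2) assms]] .
  then show "x \<in> cls Q ` vs.span G" using vs.span_mono[OF ps(2)] by blast
next
  fix x assume "x \<in> cls Q ` vs.span G"
  then obtain p where p: "x = cls Q p" "p \<in> vs.span G" by blast
  then obtain T r where T: "finite T" "T \<subseteq> G" and r: "p = (\<Sum>a\<in>T. const (r a) * a)"
    unfolding vs.span_explicit by blast
  have pT: "p \<in> vs.span T" unfolding r by (intro vs.span_sum vs.span_scale vs.span_base)
  obtain ps where ps: "set ps = T" using finite_list[OF T(1)] by blast
  then have "x \<in> ring.Span (R\<^sub>Q Q) (scalars Q) (map (cls Q) ps)"
    using T(2) p(1) pT assms Span_cls[OF order_trans[of "set ps" G]] by blast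
  then show "x \<in> linear_span Q (cls Q ` G)" using ps T(2) unfolding linear_span_def
    by (intro UN_I[of "map (cls Q) ps"]) (simp_all add: image_mono del: RQ.Span.simps)
qed

end

subsection \<open>Regularity on quotients\<close>

context ideal
begin

lemma carrier_quotient_module:
  "carrier (quotient_module R I) = (\<lambda>x. I +> x) ` carrier R"
  by (auto simp: quotient_module_def FactRing_def A_RCOSETS_def')

lemma smult_quotient_module:
  "f \<in> carrier R \<Longrightarrow> x \<in> carrier R \<Longrightarrow> f \<odot>\<^bsub>quotient_module R I\<^esub> (I +> x) = I +> (f \<otimes> x)"
  by (simp add: quotient_module_def FactRing_def rcoset_mult_add)

lemma a_rcos_eq_iff: "x \<in> carrier R \<Longrightarrow> y \<in> carrier R \<Longrightarrow> I +> x = I +> y \<longleftrightarrow> x \<ominus> y \<in> I"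
  using quotient_eq_iff_same_a_r_cos[OF ideal_axioms] by simp

text \<open>Multiplication is additive, so injectivity concerns only differences, and every ring
  element is a difference.\<close>

lemma inj_on_quotient_module_iff:
  assumes f: "f \<in> carrier R"
  shows "inj_on (\<lambda>x. f \<odot>\<^bsub>quotient_module R I\<^esub> x) (carrier (quotient_module R I)) \<longleftrightarrow>
    (\<forall>x \<in> carrier R. f \<otimes> x \<in> I \<longrightarrow> x \<in> I)"
proof -
  have "inj_on (\<lambda>x. f \<odot>\<^bsub>quotient_module R I\<^esub> x) (carrier (quotient_module R I)) \<longleftrightarrow>
    (\<forall>x \<in> carrier R. \<forall>y \<in> carrier R. f \<otimes> (x \<ominus> y) \<in> I \<longrightarrow> x \<ominus> y \<in> I)"
    unfolding inj_on_def carrier_quotient_module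
    by (simp add: smult_quotient_module f a_rcos_eq_iff r_minus r_distr a_minus_def)
  also have "\<dots> \<longleftrightarrow> (\<forall>x \<in> carrier R. f \<otimes> x \<in> I \<longrightarrow> x \<in> I)"
    by (metis minus_closed minus_zero zero_closed r_zero a_minus_def)
  finally show ?thesis .
qed

lemma a_kernel_quotient_moduleD:
  assumes "a_kernel (quotient_module R I) (quotient_module R I) (\<lambda>x. f \<odot>\<^bsub>quotient_module R I\<^esub> x)
      = (\<lambda>x. f \<odot>\<^bsub>quotient_module R I\<^esub> x) ` carrier (quotient_module R I)"
    and "f \<in> carrier R" "x \<in> carrier R" "f \<otimes> x \<in> I"
  shows "\<exists>y \<in> carrier R. x \<ominus> f \<otimes> y \<in> I"
proof -
  have "I +> (f \<otimes> x) = \<zero>\<^bsub>quotient_module R I\<^esub>"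
    using assms a_rcos_zero[OF ideal_axioms] by (simp add: quotient_module_def FactRing_def)
  then have "I +> x \<in> a_kernel (quotient_module R I) (quotient_module R I) (\<lambda>x. f \<odot>\<^bsub>quotient_module R I\<^esub> x)"
    using assms(2-4) by (simp add: a_kernel_def' carrier_quotient_module smult_quotient_module)
  then have "I +> x \<in> (\<lambda>x. f \<odot>\<^bsub>quotient_module R I\<^esub> x) ` carrier (quotient_module R I)"
    using assms(1) by simp
  then obtain y where "y \<in> carrier R" "I +> x = I +> (f \<otimes> y)"
    using assms(2) by (auto simp: carrier_quotient_module smult_quotient_module)
  then show ?thesis using a_rcos_eq_iff assms(2,3) by auto
qed

end

subsection \<open>Regular sequences in a polynomial ring\<close>

text \<open>The ring is taken as a module over itself, so \<open>idl.span S\<close> is the ideal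
  generated by \<open>S\<close>.\<close>

interpretation idl: Modules.module "(*) :: 'a::comm_ring_1 \<Rightarrow> 'a \<Rightarrow> 'a"
  by unfold_locales (simp_all add: algebra_simps)

declare idl.scale_scale [simp del]

text \<open>The set \<open>S\<close> accumulates the generators already divided out. As in
  \<open>regular_sequence\<close>, the quotients may be zero.\<close>

fun regseq :: "'a::comm_ring_1 set \<Rightarrow> 'a list \<Rightarrow> bool" where
  "regseq S [] \<longleftrightarrow> True"
| "regseq S (f # L) \<longleftrightarrow> (\<forall>g. f * g \<in> idl.span S \<longrightarrow> g \<in> idl.span S) \<and> regseq (insert f S) L"

lemma regseq_span_cong:
  "idl.span S = idl.span T \<Longrightarrow> regseq S L \<longleftrightarrow> regseq T L"
proof (induction L arbitrary: S T)
  case (Cons f L)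
  have "idl.span (insert f S) = idl.span (insert f T)"
    using Cons.prems by (simp add: idl.span_insert)
  then show ?case using Cons.IH[of "insert f S" "insert f T"] Cons.prems by simp
qed simp

lemma nzd_cong:
  fixes f f' g :: "'a::comm_ring_1"
  assumes "f - f' \<in> idl.span S"
  shows "f * g \<in> idl.span S \<longleftrightarrow> f' * g \<in> idl.span S"
proof -
  have d: "f * g - f' * g \<in> idl.span S"
    using idl.span_scale[OF assms, of g] by (simp add: algebra_simps)
  show ?thesis
    using idl.span_diff[OF _ d, of "f * g"] idl.span_add[OF d, of "f' * g"] by auto
qed

lemma span_insertI: "(x::'a::comm_ring_1) \<in> idl.span S \<Longrightarrow> x \<in> idl.span (insert f S)"
  by (meson idl.span_mono subset_iff subset_insertI)

text \<open>Entries matter only modulo \<open>S\<close>: congruent elements act alike on the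
  quotient, and adjoining either of them to \<open>S\<close> gives the same ideal.\<close>

lemma regseq_cong:
  fixes L L' :: "'a::comm_ring_1 list"
  shows "list_all2 (\<lambda>f f'. f - f' \<in> idl.span S) L L' \<Longrightarrow> regseq S L \<Longrightarrow> regseq S L'"
proof (induction L arbitrary: L' S)
  case (Cons f L)
  then obtain f' L1 where L': "L' = f' # L1" and f': "f - f' \<in> idl.span S"
    and L1: "list_all2 (\<lambda>f f'. f - f' \<in> idl.span S) L L1"
    by (auto simp: list_all2_Cons1)
  have "list_all2 (\<lambda>g g'. g - g' \<in> idl.span (insert f S)) L L1"
    using L1 by (rule list_all2_mono) (rule span_insertI)
  then have "regseq (insert f S) L1"
    by (rule Cons.IH) (use Cons.prems(2) in \<open>unfold regseq.simps, blast\<close>)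
  then show ?case
    using Cons.prems nzd_cong[OF f'] regseq_span_cong[OF idl.eq_span_insert_eq[OF f']]
    by (simp add: L')
qed simp

lemma regseq_appendD: "regseq S (L @ L') \<Longrightarrow> regseq S L"
  by (induction L arbitrary: S) auto

lemma regseq_append: "regseq S (L @ L') \<longleftrightarrow> regseq S L \<and> regseq (set L \<union> S) L'"
  by (induction L arbitrary: S) auto

text \<open>The hypothesis is exactness of
  \<open>0 \<rightarrow> P/(T) \<rightarrow> P/(U) \<rightarrow> P/(x, U) \<rightarrow> 0\<close>, where the first map is multiplication by \<open>x\<close>;
  regularity passes from the outer terms to the middle one.\<close>

lemma regseq_middle:
  fixes x :: "'a::comm_ring_1"
  assumes "\<And>g. x * g \<in> idl.span U \<longleftrightarrow> g \<in> idl.span T"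
    and "regseq (insert x U) L" "regseq T L"
  shows "regseq U L"
  using assms
proof (induction L arbitrary: U T)
  case (Cons f L)
  note ex = Cons.prems(1)
  have nx: "g \<in> idl.span (insert x U)" if "f * g \<in> idl.span (insert x U)" for g
    using Cons.prems(2) that by simp
  have nt: "g \<in> idl.span T" if "f * g \<in> idl.span T" for g
    using Cons.prems(3) that by simp
  \<comment> \<open>A diagram chase: \<open>g\<close> vanishes in the right-hand quotient, so it is
    \<open>k * x\<close> modulo \<open>U\<close>. Then \<open>x * (f * k)\<close> is zero modulo
    \<open>U\<close>, exactness puts \<open>f * k\<close> into the ideal of \<open>T\<close>, and
    regularity there gives \<open>k\<close>.\<close>
  have nu: "g \<in> idl.span U" if fg: "f * g \<in> idl.span U" for g
  proof -
    from nx[OF span_insertI[OF fg]] obtain k where k: "g - k * x \<in> idl.span U"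
      by (auto simp: idl.span_breakdown_eq)
    have "x * (f * k) \<in> idl.span U"
    proof -
      have "x * (f * k) = f * g - f * (g - k * x)" by (simp add: algebra_simps)
      then show ?thesis using idl.span_diff[OF fg idl.span_scale[OF k, of f]] by (simp only:)
    qed
    then have "k \<in> idl.span T" using ex nt by blast
    then have "k * x \<in> idl.span U" using ex by (simp add: mult.commute)
    from idl.span_add[OF k this] show ?thesis by simp
  qed
  \<comment> \<open>The sequence stays exact when \<open>f\<close> joins both \<open>U\<close> and
    \<open>T\<close>: if \<open>x * g\<close> is \<open>u * f\<close> modulo \<open>U\<close>,
    regularity of \<open>f\<close> modulo \<open>x\<close> and \<open>U\<close> makes
    \<open>u\<close> a multiple \<open>k * x\<close> modulo \<open>U\<close>, and exactness applies
    to \<open>g - k * f\<close>.\<close>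
  have "x * g \<in> idl.span (insert f U) \<longleftrightarrow> g \<in> idl.span (insert f T)" for g
  proof
    assume "x * g \<in> idl.span (insert f U)"
    then obtain u where u: "x * g - u * f \<in> idl.span U" by (auto simp: idl.span_breakdown_eq)
    have "f * u \<in> idl.span (insert x U)"
    proof -
      have "f * u - g * x \<in> idl.span U"
        using idl.span_neg[OF u] by (simp add: algebra_simps)
      then show ?thesis unfolding idl.span_breakdown_eq by blast
    qed
    from nx[OF this] obtain k where k: "u - k * x \<in> idl.span U"
      by (auto simp: idl.span_breakdown_eq)
    have "x * (g - k * f) \<in> idl.span U"
      using idl.span_add[OF u idl.span_scale[OF k, of f]] by (simp add: algebra_simps)
    then have "g - k * f \<in> idl.span T" using ex by blast
    then show "g \<in> idl.span (insert f T)" unfolding idl.span_breakdown_eq by blast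
  next
    assume "g \<in> idl.span (insert f T)"
    then obtain k where "g - k * f \<in> idl.span T" by (auto simp: idl.span_breakdown_eq)
    then have "x * (g - k * f) \<in> idl.span U" using ex by blast
    then have "x * g - (x * k) * f \<in> idl.span U" by (simp add: algebra_simps)
    then show "x * g \<in> idl.span (insert f U)" unfolding idl.span_breakdown_eq by blast
  qed
  moreover have "regseq (insert x (insert f U)) L" "regseq (insert f T) L"
    using Cons.prems by (simp_all add: insert_commute)
  ultimately have "regseq (insert f U) L" by (rule Cons.IH)
  with nu show ?case by simp
qed simp

text \<open>Multiplication by \<open>x\<close> embeds the quotient by \<open>y\<close> into the
  quotient by \<open>x * y\<close>, with cokernel the quotient by \<open>x\<close>. This is the
  exact sequence required by \<open>regseq_middle\<close>.\<close>

lemma regseq_mult: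
  fixes x y :: "'a::comm_ring_1"
  assumes "regseq S (L1 @ x # L2)" "regseq S (L1 @ y # L2)"
  shows "regseq S (L1 @ (x * y) # L2)"
proof -
  let ?S = "set L1 \<union> S"
  have L1: "regseq S L1" and x: "\<And>g. x * g \<in> idl.span ?S \<Longrightarrow> g \<in> idl.span ?S"
    and y: "\<And>g. y * g \<in> idl.span ?S \<Longrightarrow> g \<in> idl.span ?S"
    and xL: "regseq (insert x ?S) L2" and yL: "regseq (insert y ?S) L2"
    using assms unfolding regseq_append regseq.simps by blast+
  have xy: "g \<in> idl.span ?S" if "x * y * g \<in> idl.span ?S" for g
    using x[of "y * g"] y[of g] that by (simp add: mult.assoc)
  have "x * g \<in> idl.span (insert (x * y) ?S) \<longleftrightarrow> g \<in> idl.span (insert y ?S)" for g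
  proof -
    have "x * g - k * (x * y) \<in> idl.span ?S \<longleftrightarrow> g - k * y \<in> idl.span ?S" for k
      using x[of "g - k * y"] idl.span_scale[of "g - k * y" ?S x] by (auto simp: algebra_simps)
    then show ?thesis by (simp add: idl.span_breakdown_eq)
  qed
  moreover have "regseq (insert x (insert (x * y) ?S)) L2"
  proof -
    have "idl.span (insert (x * y) (insert x ?S)) = idl.span (insert x ?S)"
      using idl.eq_span_insert_eq[of "x * y" 0 "insert x ?S"]
        idl.span_scale[OF idl.span_base, of x "insert x ?S" y]
      by (simp add: idl.span_insert[of 0] mult.commute)
    then have "idl.span (insert x (insert (x * y) ?S)) = idl.span (insert x ?S)"
      by (simp add: insert_commute)
    then show ?thesis using xL regseq_span_cong by blast
  qed
  ultimately have "regseq (insert (x * y) ?S) L2"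
    using yL by (rule regseq_middle)
  with L1 xy show ?thesis by (auto simp: regseq_append)
qed

section \<open>Truncation by degree and reordering of regular sequences\<close>

type_synonym 'x mpoly = "'x multiset \<Rightarrow>\<^sub>0 rat"

lift_definition low :: "nat \<Rightarrow> 'x mpoly \<Rightarrow> 'x mpoly" is
  "\<lambda>n p m. if size m < n then p m else 0"
  by (erule finite_subset[rotated]) auto

definition homog :: "nat \<Rightarrow> 'x mpoly \<Rightarrow> bool" where
  "homog e p \<longleftrightarrow> (\<forall>m \<in> Poly_Mapping.keys p. size m = e)"

lemma low_add: "low n (p + q) = low n p + low n q"
  by (rule poly_mapping_eqI) (simp add: low.rep_eq lookup_add)

lemma low_0 [simp]: "low n 0 = 0"
  by (rule poly_mapping_eqI) (simp add: low.rep_eq)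

lemma low_single: "low n (Poly_Mapping.single m v) = (if size m < n then Poly_Mapping.single m v else 0)"
  by (rule poly_mapping_eqI) (auto simp: low.rep_eq lookup_single when_def)

lemma low_eq_self: "\<exists>n. low n p = p"
proof -
  define n where "n = Suc (Max (insert 0 (size ` Poly_Mapping.keys p)))"
  have "size m < n" if "m \<in> Poly_Mapping.keys p" for m
    unfolding n_def using that by (auto intro!: le_imp_less_Suc Max_ge)
  then have "low n p = p"
    by (intro poly_mapping_eqI) (auto simp: low.rep_eq in_keys_iff)
  then show ?thesis ..
qed

text \<open>Truncated subtraction is right here: for \<open>n\<close> below \<open>e\<close> the
  product has no term of degree below \<open>n\<close>, and \<open>low 0\<close> vanishes.\<close>

lemma low_mult:
  assumes "homog e f"
  shows "low n (f * g) = f * low (n - e) g"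
proof -
  have *: "low n (Poly_Mapping.single m v * g) = Poly_Mapping.single m v * low (n - e) g"
    if "size m = e" for m v
    by (induction g rule: poly_mapping_single_induct)
       (auto simp: algebra_simps low_add mult_single low_single that)
  have "f = (\<Sum>m\<in>Poly_Mapping.keys f. Poly_Mapping.single m (Poly_Mapping.lookup f m))"
    by (intro poly_mapping_eqI) (auto simp: lookup_sum lookup_single when_def in_keys_iff if_distrib cong: if_cong)
  moreover have "low n ((\<Sum>m\<in>K. Poly_Mapping.single m (Poly_Mapping.lookup f m)) * g)
    = (\<Sum>m\<in>K. Poly_Mapping.single m (Poly_Mapping.lookup f m)) * low (n - e) g"
    if "finite K" "K \<subseteq> Poly_Mapping.keys f" for K
    using that
  proof (induction K)
    case (insert m K)
    then have "size m = e" using assms by (auto simp: homog_def)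
    from insert *[OF this] show ?case by (simp add: distrib_right low_add)
  qed simp
  ultimately show ?thesis by (metis finite_keys order_refl)
qed

lemma low_homog_eq_0: "homog e f \<Longrightarrow> n \<le> e \<Longrightarrow> low n (f * g) = 0"
proof -
  have "low 0 q = 0" for q :: "'a mpoly" by (rule poly_mapping_eqI) (simp add: low.rep_eq)
  then show "homog e f \<Longrightarrow> n \<le> e \<Longrightarrow> low n (f * g) = 0" by (simp add: low_mult)
qed

text \<open>Truncating a multiple of a homogeneous generator only truncates its coefficient, so the
  ideal is preserved.\<close>

lemma low_span:
  assumes "\<forall>f \<in> S. \<exists>e. homog e f" "x \<in> idl.span S"
  shows "low n x \<in> idl.span S"
  using assms(2)
proof (induction rule: idl.span_induct_alt)
  case base
  then show ?case by (simp add: idl.span_zero)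
next
  case (step c x y)
  then obtain e where "homog e x" using assms(1) by blast
  then have "low n (c * x + y) = low (n - e) c * x + low n y"
    by (simp add: low_add low_mult mult.commute[of _ x])
  with step show ?case by (simp add: idl.span_add idl.span_scale idl.span_base)
qed

lemma homog_power: "homog e f \<Longrightarrow> homog (k * e) (f ^ k)"
proof (induction k)
  case (Suc k)
  then show ?case using keys_mult[of f "f ^ k"] by (fastforce simp: homog_def)
qed (simp add: homog_def)

text \<open>An element killed by \<open>f\<close> modulo \<open>S\<close> is divisible by every
  power of \<open>h\<close> modulo \<open>S\<close>. Since \<open>h\<close> has positive degree and
  \<open>S\<close> is homogeneous, truncation shows that such an element lies in the ideal of
  \<open>S\<close>.\<close>

lemma regseq_swap:
  fixes f h :: "'x mpoly"
  assumes S: "\<forall>f \<in> S. \<exists>e. homog e f" and h: "homog e h" "e > 0"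
    and reg: "regseq S (h # f # L)"
  shows "regseq S (f # h # L)"
proof -
  have nh: "g \<in> idl.span S" if "h * g \<in> idl.span S" for g
    using reg that by simp
  have nf: "\<exists>k. g - k * h \<in> idl.span S" if "f * g - k' * h \<in> idl.span S" for g k'
    using reg that by (auto simp: idl.span_breakdown_eq)
  have f: "g \<in> idl.span S" if fg: "f * g \<in> idl.span S" for g
  proof -
    \<comment> \<open>Since \<open>f\<close> is regular modulo \<open>h\<close>, the cofactor
      \<open>k\<close> is again a multiple of \<open>h\<close>; since \<open>h\<close> is regular,
      the new cofactor is again killed by \<open>f\<close>.\<close>
    have "\<exists>k. f * k \<in> idl.span S \<and> g - k * h ^ n \<in> idl.span S" for n
    proof (induction n)
      case 0
      have "f * g \<in> idl.span S \<and> g - g * h ^ 0 \<in> idl.span S" using fg by (simp add: idl.span_zero)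
      then show ?case by blast
    next
      case (Suc n)
      then obtain k where k: "f * k \<in> idl.span S" "g - k * h ^ n \<in> idl.span S" by blast
      from nf[of k 0] k obtain k' where k': "k - k' * h \<in> idl.span S" by auto
      have "h * (f * k') \<in> idl.span S"
      proof -
        have "h * (f * k') = f * k - f * (k - k' * h)" by (simp add: algebra_simps)
        then show ?thesis using idl.span_diff[OF k(1) idl.span_scale[OF k', of f]] by (simp only:)
      qed
      moreover have "g - k' * h ^ Suc n \<in> idl.span S"
        using idl.span_add[OF k(2) idl.span_scale[OF k', of "h ^ n"]] by (simp add: algebra_simps)
      ultimately show ?case using nh by blast
    qed
    \<comment> \<open>With \<open>n\<close> above the degree of \<open>g\<close>, truncation below
      \<open>n\<close> keeps \<open>g\<close> and erases the multiple of
      \<open>h ^ n\<close>.\<close>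
    moreover obtain n where n: "low n g = g" using low_eq_self by blast
    ultimately obtain k where k: "g - k * h ^ n \<in> idl.span S" by blast
    have "low n (h ^ n * k) = 0"
      using h by (intro low_homog_eq_0[OF homog_power]) auto
    moreover have "low n g = low n (g - k * h ^ n) + low n (h ^ n * k)"
      by (simp add: low_add[symmetric] mult.commute)
    ultimately show ?thesis using low_span[OF S k, of n] n by simp
  qed
  have g: "g \<in> idl.span (insert f S)" if hg: "h * g \<in> idl.span (insert f S)" for g
  proof -
    from hg obtain u where u: "h * g - u * f \<in> idl.span S" by (auto simp: idl.span_breakdown_eq)
    have "f * u - g * h \<in> idl.span S"
      using idl.span_neg[OF u] by (simp add: algebra_simps)
    from nf[OF this] obtain k where k: "u - k * h \<in> idl.span S" by blast
    have "h * (g - k * f) \<in> idl.span S"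
      using idl.span_add[OF u idl.span_scale[OF k, of f]] by (simp add: algebra_simps)
    from nh[OF this] show ?thesis unfolding idl.span_breakdown_eq by blast
  qed
  have "regseq (insert h (insert f S)) L"
    using reg by (simp only: regseq.simps insert_commute[of h])
  then show ?thesis using f g unfolding regseq.simps by blast
qed

text \<open>Repeated swapping; each entry passed by \<open>h\<close> joins \<open>S\<close>, which
  has to stay homogeneous.\<close>

lemma regseq_move:
  fixes h :: "'x mpoly"
  assumes "\<forall>f \<in> S. \<exists>e. homog e f" "\<forall>f \<in> set L1. \<exists>e. homog e f" "homog e h" "e > 0"
    and "regseq S (h # L1 @ L2)"
  shows "regseq S (L1 @ h # L2)"
  using assms
proof (induction L1 arbitrary: S)
  case (Cons f L1)
  have "regseq S (f # h # L1 @ L2)"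
    using regseq_swap[OF Cons.prems(1,3,4)] Cons.prems(5) unfolding append_Cons .
  moreover from this have "regseq (insert f S) (L1 @ h # L2)"
    using Cons.prems by (intro Cons.IH) simp_all
  ultimately show ?case unfolding append_Cons regseq.simps by blast
qed simp

section \<open>Ideals of variables and the coefficients of a product of two series\<close>

definition var :: "'x \<Rightarrow> 'x mpoly" where
  "var x = Poly_Mapping.single {#x#} 1"

lemma homog_var: "homog 1 (var x)"
  by (simp add: homog_def var_def)

lemma homog_var_mult: "homog 2 (var x * var y)"
  by (simp add: homog_def var_def mult_single)

lemma homog_sum: "(\<And>i. i \<in> A \<Longrightarrow> homog e (f i)) \<Longrightarrow> homog e (sum f A)"
  using keys_sum[of f A] by (fastforce simp: homog_def)

lemma lookup_var_mult: "Poly_Mapping.lookup (var x * g) (add_mset x m) = Poly_Mapping.lookup g m"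
  by (induction g rule: poly_mapping_single_induct)
     (auto simp: var_def algebra_simps lookup_add mult_single lookup_single when_def)

lemma span_vars_iff:
  "g \<in> idl.span (var ` V) \<longleftrightarrow> (\<forall>m \<in> Poly_Mapping.keys g. \<exists>x \<in> V. x \<in># m)"
proof
  assume "g \<in> idl.span (var ` V)"
  then show "\<forall>m \<in> Poly_Mapping.keys g. \<exists>x \<in> V. x \<in># m"
  proof (induction rule: idl.span_induct_alt)
    case (step c y z)
    then obtain x where x: "x \<in> V" "y = var x" by blast
    have "\<exists>x \<in> V. x \<in># m" if "m \<in> Poly_Mapping.keys (c * y)" for m
      using keys_mult[of c y] that x by (fastforce simp: var_def)
    with step show ?case using Poly_Mapping.keys_add[of "c * y" z] by blast
  qed simp
next
  assume *: "\<forall>m \<in> Poly_Mapping.keys g. \<exists>x \<in> V. x \<in># m"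
  have "g = (\<Sum>m\<in>Poly_Mapping.keys g. Poly_Mapping.single m (Poly_Mapping.lookup g m))"
    by (intro poly_mapping_eqI) (auto simp: lookup_sum lookup_single when_def in_keys_iff if_distrib cong: if_cong)
  also have "\<dots> \<in> idl.span (var ` V)"
  proof (rule idl.span_sum)
    fix m assume "m \<in> Poly_Mapping.keys g"
    with * obtain x where x: "x \<in> V" "x \<in># m" by blast
    then have "Poly_Mapping.single m (Poly_Mapping.lookup g m)
        = Poly_Mapping.single (m - {#x#}) (Poly_Mapping.lookup g m) * var x"
      by (simp add: var_def mult_single)
    also have "\<dots> \<in> idl.span (var ` V)"
      by (intro idl.span_scale idl.span_base imageI x)
    finally show "Poly_Mapping.single m (Poly_Mapping.lookup g m) \<in> idl.span (var ` V)" .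
  qed
  finally show "g \<in> idl.span (var ` V)" .
qed

text \<open>Multiplication by \<open>var x\<close> adds the letter \<open>x\<close> to each monomial
  without cancellation, so a letter of \<open>V\<close>, being different from \<open>x\<close>, was
  there before.\<close>

lemma var_nzd:
  assumes "x \<notin> V" "var x * g \<in> idl.span (var ` V)"
  shows "g \<in> idl.span (var ` V)"
  unfolding span_vars_iff
proof
  fix m assume "m \<in> Poly_Mapping.keys g"
  then have "add_mset x m \<in> Poly_Mapping.keys (var x * g)"
    by (simp add: in_keys_iff lookup_var_mult)
  with assms show "\<exists>y \<in> V. y \<in># m" unfolding span_vars_iff by fastforce
qed

text \<open>\<open>conv p q k\<close> is the coefficient of \<open>t\<^sup>k\<close> in the product of the power series
  \<open>\<Sum>\<^sub>i a\<^bsub>p+i\<^esub> t\<^sup>i\<close> and \<open>\<Sum>\<^sub>j b\<^bsub>q+j\<^esub> t\<^sup>j\<close>, with \<open>a\<^sub>i = var (True, i)\<close> and \<open>b\<^sub>j = var (False, j)\<close>.\<close>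

definition conv :: "nat \<Rightarrow> nat \<Rightarrow> nat \<Rightarrow> (bool \<times> nat) mpoly" where
  "conv p q k = (\<Sum>i\<le>k. var (True, p + i) * var (False, q + (k - i)))"

text \<open>Modulo these variables the two series are divisible by the powers \<open>p\<close> and
  \<open>q\<close> of t, and the remaining factors are the series that define
  \<open>conv p q\<close>.\<close>

definition first_vars :: "nat \<Rightarrow> nat \<Rightarrow> (bool \<times> nat) set" where
  "first_vars p q = {True} \<times> {..<p} \<union> {False} \<times> {..<q}"

lemma homog_conv: "homog 2 (conv p q k)"
  unfolding conv_def by (intro homog_sum homog_var_mult)

lemma conv_0: "conv p q 0 = var (True, p) * var (False, q)"
  by (simp add: conv_def)

text \<open>Splitting off the first summand shows the index shift: modulo
  \<open>var (True, p)\<close>, index \<open>Suc k\<close> becomes index \<open>k\<close> of the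
  shifted series.\<close>

lemma conv_Suc_left: "conv p q (Suc k) = var (True, p) * var (False, q + Suc k) + conv (Suc p) q k"
  unfolding conv_def by (subst sum.atMost_Suc_shift) simp

lemma conv_Suc_right: "conv p q (Suc k) = conv p (Suc q) k + var (True, p + Suc k) * var (False, q)"
  unfolding conv_def by (simp add: Suc_diff_le)

lemma first_vars_Suc:
  "first_vars (Suc p) q = insert (True, p) (first_vars p q)"
  "first_vars p (Suc q) = insert (False, q) (first_vars p q)"
  by (auto simp: first_vars_def)

lemma regseq_conv:
  "distinct L \<Longrightarrow> regseq (var ` first_vars p q) (map (conv p q) L)"
\<comment> \<open>With \<open>Suc\<close>, an entry 0 also has positive weight, so that removing it
  lowers the measure. The offsets \<open>p\<close> and \<open>q\<close> vary because dividing out a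
  leading variable raises one of them.\<close>
proof (induction "\<Sum>k\<leftarrow>L. Suc k" arbitrary: L p q rule: less_induct)
  case less
  let ?S = "var ` first_vars p q"
  let ?a = "var (True, p)" and ?b = "var (False, q)"
  have hS: "\<forall>f \<in> ?S. \<exists>e. homog e f" by (auto intro: homog_var)
  have hL: "\<forall>f \<in> set (map (conv p q) K). \<exists>e. homog e f" for K by (auto intro: homog_conv)
  have a: "g \<in> idl.span ?S" if "?a * g \<in> idl.span ?S" for g
    using that by (rule var_nzd[rotated]) (simp add: first_vars_def)
  have b: "g \<in> idl.span ?S" if "?b * g \<in> idl.span ?S" for g
    using that by (rule var_nzd[rotated]) (simp add: first_vars_def)
  \<comment> \<open>Without the index 0, all indices drop by one modulo a leading variable and stay
    distinct, so the induction hypothesis applies to the shifted series.\<close>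
  have ab: "regseq ?S (?a # map (conv p q) K)" "regseq ?S (?b # map (conv p q) K)"
    if K: "distinct K" "0 \<notin> set K" "(\<Sum>k\<leftarrow>K. Suc (k - 1)) < (\<Sum>k\<leftarrow>L. Suc k)" for K
  proof -
    let ?K = "map (\<lambda>k. k - 1) K"
    have dK: "distinct ?K"
      using K(1,2) by (auto simp: distinct_map inj_on_def) (metis Suc_pred neq0_conv)
    have lt: "(\<Sum>k\<leftarrow>?K. Suc k) < (\<Sum>k\<leftarrow>L. Suc k)"
      using K(3) by (simp add: comp_def)
    have "regseq (insert ?a ?S) (map (conv p q) K)"
    proof (rule regseq_cong)
      show "regseq (insert ?a ?S) (map (conv (Suc p) q) ?K)"
        using less.hyps[OF lt dK, of "Suc p" q] by (simp add: first_vars_Suc)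
      have "conv (Suc p) q (k - 1) - conv p q k \<in> idl.span (insert ?a ?S)" if "k \<in> set K" for k
      proof -
        from that K(2) obtain l where l: "k = Suc l" by (metis not0_implies_Suc)
        have "(- var (False, q + Suc l)) * ?a \<in> idl.span (insert ?a ?S)"
          by (intro idl.span_scale idl.span_base) simp
        then show ?thesis by (simp add: l conv_Suc_left algebra_simps)
      qed
      then show "list_all2 (\<lambda>f f'. f - f' \<in> idl.span (insert ?a ?S))
          (map (conv (Suc p) q) ?K) (map (conv p q) K)"
        by (simp add: list_all2_conv_all_nth)
    qed
    with a show "regseq ?S (?a # map (conv p q) K)" by simp
    have "regseq (insert ?b ?S) (map (conv p q) K)"
    proof (rule regseq_cong)
      show "regseq (insert ?b ?S) (map (conv p (Suc q)) ?K)"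
        using less.hyps[OF lt dK, of p "Suc q"] by (simp add: first_vars_Suc)
      have "conv p (Suc q) (k - 1) - conv p q k \<in> idl.span (insert ?b ?S)" if "k \<in> set K" for k
      proof -
        from that K(2) obtain l where l: "k = Suc l" by (metis not0_implies_Suc)
        have "(- var (True, p + Suc l)) * ?b \<in> idl.span (insert ?b ?S)"
          by (intro idl.span_scale idl.span_base) simp
        then show ?thesis by (simp add: l conv_Suc_right algebra_simps)
      qed
      then show "list_all2 (\<lambda>f f'. f - f' \<in> idl.span (insert ?b ?S))
          (map (conv p (Suc q)) ?K) (map (conv p q) K)"
        by (simp add: list_all2_conv_all_nth)
    qed
    with b show "regseq ?S (?b # map (conv p q) K)" by simp
  qed
  have dec: "(\<Sum>k\<leftarrow>K. Suc (k - 1)) \<le> (\<Sum>k\<leftarrow>K. Suc k)" for K :: "nat list"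
    by (rule sum_list_mono) simp
  show ?case
  proof (cases "0 \<in> set L")
    case True
    then obtain L1 L2 where L: "L = L1 @ 0 # L2" by (auto simp: in_set_conv_decomp)
    let ?K = "L1 @ L2"
    have K: "distinct ?K" "0 \<notin> set ?K" using less.prems by (auto simp: L)
    have lt: "(\<Sum>k\<leftarrow>?K. Suc (k - 1)) < (\<Sum>k\<leftarrow>L. Suc k)"
      using dec[of ?K] by (simp add: L)
    \<comment> \<open>Both leading variables are moved to the position of the index 0, where their
      product is \<open>conv p q 0\<close>.\<close>
    have "regseq ?S (map (conv p q) L1 @ ?a # map (conv p q) L2)"
      by (rule regseq_move[OF hS hL homog_var]) (use ab(1)[OF K lt] in simp_all)
    moreover have "regseq ?S (map (conv p q) L1 @ ?b # map (conv p q) L2)"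
      by (rule regseq_move[OF hS hL homog_var]) (use ab(2)[OF K lt] in simp_all)
    ultimately show ?thesis
      using regseq_mult by (simp add: L conv_0)
  next
    case False
    show ?thesis
    proof (cases L)
      case (Cons l L')
      with False have "(\<Sum>k\<leftarrow>L. Suc (k - 1)) < (\<Sum>k\<leftarrow>L. Suc k)"
        using dec[of L'] by (auto intro!: add_less_le_mono)
      then have "regseq ?S (?a # map (conv p q) L @ [])"
        using ab(1)[OF less.prems False] by simp
      then have "regseq ?S (map (conv p q) L @ ?a # [])"
        by (rule regseq_move[OF hS hL homog_var zero_less_one])
      then show ?thesis by (rule regseq_appendD)
    qed simp
  qed
qed

subsection \<open>Necessity: linear syzygies\<close>

lemma subspace_ideal:
  assumes "ideal K (free_algebra X)"
  shows "vs.subspace K"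
proof -
  interpret K: ideal K "free_algebra X" by fact
  show ?thesis
    using additive_subgroup.zero_closed[OF K.is_additive_subgroup]
      additive_subgroup.a_closed[OF K.is_additive_subgroup] K.I_l_closed[OF _ const_closed]
    by (intro vs.subspaceI) (auto simp: free_algebra_ops)
qed

definition quad_poly :: "'v \<Rightarrow> 'v \<Rightarrow> nat \<Rightarrow> nat \<Rightarrow> 'v free_alg" where
  "quad_poly i j k p = (\<Sum>l\<le>k. const (of_nat ((k - l) choose p)) * gen (i, l) * gen (j, k - l))"

definition quad_polys :: "('v, 'e) pre_digraph \<Rightarrow> 'v free_alg set" where
  "quad_polys Q = {quad_poly i j k p | i j k p. i \<in> verts Q \<and> j \<in> verts Q \<and> p < num_arrows Q i j}"

lemma quad_relation_eq: "quad_relation Q i j k p = cls Q (quad_poly i j k p)"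
proof -
  have "(\<Sum>(k\<^sub>1, k\<^sub>2) \<in> {(k\<^sub>1, k\<^sub>2). k\<^sub>1 + k\<^sub>2 = k}.
      const (of_nat (k\<^sub>2 choose p)) * gen (i, k\<^sub>1) * gen (j, k\<^sub>2)) = quad_poly i j k p"
    unfolding quad_poly_def
    by (rule sum.reindex_bij_witness[of _ "\<lambda>l. (l, k - l)" fst]) auto
  then show ?thesis by (simp add: quad_relation_def)
qed

lemma quad_relations_eq: "quad_relations Q = cls Q ` quad_polys Q"
  unfolding quad_relations_def quad_polys_def quad_relation_eq by blast

lemma gen_in: "i \<in> verts Q \<Longrightarrow> gen (i, k) \<in> carrier (FA Q)"
  by (rule gen_closed) (simp add: gens_def)

text \<open>This ideal of the free algebra contains the supercommutators and all representatives of
  relations, but no nonzero linear form.\<close>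

definition long_polys :: "'g set \<Rightarrow> ('g word \<Rightarrow>\<^sub>0 rat) set" where
  "long_polys X = {p \<in> carrier (free_algebra X). \<forall>w \<in> Poly_Mapping.keys p. 2 \<le> length (letters w)}"

lemma ideal_long_polys: "ideal (long_polys X) (free_algebra X)"
proof (rule idealI_free_algebra)
  have *: "2 \<le> length (letters w)" if "w \<in> Poly_Mapping.keys (p * q)"
    "(\<forall>w \<in> Poly_Mapping.keys p. 2 \<le> length (letters w)) \<or> (\<forall>w \<in> Poly_Mapping.keys q. 2 \<le> length (letters w))"
    for w and p q :: "'g word \<Rightarrow>\<^sub>0 rat"
    using keys_mult[of p q] that by (fastforce simp: plus_word_def)
  fix p q assume p: "p \<in> long_polys X" and q: "q \<in> carrier (free_algebra X)"
  show "q * p \<in> long_polys X" "p * q \<in> long_polys X"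
    using p q *[of _ q p] *[of _ p q] by (auto simp: long_polys_def mult_closed)
next
  fix p q assume "p \<in> long_polys X" "q \<in> long_polys X"
  moreover from this have "2 \<le> length (letters w)" if "w \<in> Poly_Mapping.keys (p + q)" for w
    using Poly_Mapping.keys_add[of p q] that by (auto simp: long_polys_def)
  ultimately show "p + q \<in> long_polys X" by (auto simp: long_polys_def add_closed)
qed (auto simp: long_polys_def zero_closed)

lemmas subspace_long_polys = subspace_ideal[OF ideal_long_polys]

lemma supercomm_ideal_long: "p \<in> supercomm_ideal X par \<Longrightarrow> p \<in> long_polys X"
  using supercomm_ideal_quadratic(1) supercomm_ideal_carrier by (auto simp: long_polys_def)

lemma gen_mult_gen: "gen x * gen y = Poly_Mapping.single (Word [x, y]) 1"
  by (simp add: gen_def mult_single plus_word_def)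

lemma gen_mult_long: "x \<in> X \<Longrightarrow> y \<in> X \<Longrightarrow> gen x * gen y \<in> long_polys X"
  by (simp add: long_polys_def gen_mult_gen carrier_free_algebra_iff)

lemma quad_poly_long: "i \<in> verts Q \<Longrightarrow> j \<in> verts Q \<Longrightarrow> quad_poly i j k p \<in> long_polys (gens Q)"
  unfolding quad_poly_def mult.assoc
  by (intro vs.subspace_sum[OF subspace_long_polys] vs.subspace_scale[OF subspace_long_polys] gen_mult_long)
     (auto simp: gens_def)

lemma quad_polys_long: "quad_polys Q \<subseteq> long_polys (gens Q)"
  by (auto simp: quad_polys_def quad_poly_long)

lemma long_polys_carrier: "long_polys X \<subseteq> carrier (free_algebra X)"
  by (auto simp: long_polys_def)

lemma span_quad_polys_long: "vs.span (quad_polys Q) \<subseteq> long_polys (gens Q)"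
  by (rule vs.span_minimal[OF quad_polys_long subspace_long_polys])

lemma span_quad_polys_carrier: "vs.span (quad_polys Q) \<subseteq> carrier (FA Q)"
  using span_quad_polys_long long_polys_carrier by blast

lemma quad_poly_0: "quad_poly i j 0 0 = gen (i, 0) * gen (j, 0)"
  by (simp add: quad_poly_def)

lemma quad_poly_1: "quad_poly i j 1 1 = gen (i, 0) * gen (j, 1)"
  by (simp add: quad_poly_def)

text \<open>The functional that kills the ideal takes the value 1 on this product, or 2 when both
  letters agree and are even.\<close>

lemma gen_mult_notin:
  assumes "x \<noteq> y \<or> even (par x)"
  shows "gen x * gen y \<notin> supercomm_ideal X par"
proof
  assume "gen x * gen y \<in> supercomm_ideal X par"
  from supercomm_ideal_quadratic(2)[OF this, of x y] assms show False
    by (cases "x = y") (auto simp: gen_mult_gen lookup_single when_def)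
qed

lemma ideal_cls_image:
  assumes "ideal K (FA Q)"
  shows "ideal (cls Q ` K) (R\<^sub>Q Q)"
proof (rule idealI[OF ring_free_supercomm_algebra])
  interpret RQ: ring "R\<^sub>Q Q" by (rule ring_free_supercomm_algebra)
  interpret K: ideal K "FA Q" by fact
  note sub = subspace_ideal[OF assms]
  have K: "p \<in> carrier (FA Q)" if "p \<in> K" for p using K.Icarr[OF that] .
  show "subgroup (cls Q ` K) (add_monoid (R\<^sub>Q Q))"
  proof (rule RQ.add.subgroupI)
    show "cls Q ` K \<subseteq> carrier (R\<^sub>Q Q)" using K cls_in by blast
    show "cls Q ` K \<noteq> {}" using vs.subspace_0[OF sub] by blast
    fix a assume "a \<in> cls Q ` K"
    then obtain p where p: "a = cls Q p" "p \<in> K" by blast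
    have "\<ominus>\<^bsub>R\<^sub>Q Q\<^esub> a = \<zero>\<^bsub>R\<^sub>Q Q\<^esub> \<ominus>\<^bsub>R\<^sub>Q Q\<^esub> a"
      using p K[OF p(2)] by (simp add: a_minus_def cls_in)
    also have "\<dots> = cls Q (0 - p)"
      unfolding p(1) cls_zero by (rule cls_minus[OF zero_closed K[OF p(2)]])
    finally show "\<ominus>\<^bsub>R\<^sub>Q Q\<^esub> a \<in> cls Q ` K" using vs.subspace_neg[OF sub p(2)] by simp
    fix b assume "b \<in> cls Q ` K"
    then obtain q where q: "b = cls Q q" "q \<in> K" by blast
    show "a \<oplus>\<^bsub>R\<^sub>Q Q\<^esub> b \<in> cls Q ` K"
      using vs.subspace_add[OF sub p(2) q(2)] by (simp add: p(1) q(1) cls_add K p(2) q(2))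
  qed
  fix a x assume "a \<in> cls Q ` K" "x \<in> carrier (R\<^sub>Q Q)"
  then obtain p q where p: "a = cls Q p" "p \<in> K" and q: "x = cls Q q" "q \<in> carrier (FA Q)"
    by (auto simp: carrier_RQ)
  show "x \<otimes>\<^bsub>R\<^sub>Q Q\<^esub> a \<in> cls Q ` K" "a \<otimes>\<^bsub>R\<^sub>Q Q\<^esub> x \<in> cls Q ` K"
    using K.I_l_closed[OF p(2) q(2)] K.I_r_closed[OF p(2) q(2)]
    by (simp_all add: p(1) q cls_mult K p(2) free_algebra_ops)
qed

lemma ideal_cls_preimage:
  assumes "ideal J (R\<^sub>Q Q)"
  shows "ideal {p \<in> carrier (FA Q). cls Q p \<in> J} (FA Q)"
proof -
  interpret J: ideal J "R\<^sub>Q Q" by fact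
  show ?thesis
  proof (rule idealI_free_algebra)
    show "0 \<in> {p \<in> carrier (FA Q). cls Q p \<in> J}"
      using additive_subgroup.zero_closed[OF J.is_additive_subgroup] by (simp add: zero_closed cls_zero)
  next
    fix p q assume "p \<in> {p \<in> carrier (FA Q). cls Q p \<in> J}" "q \<in> {p \<in> carrier (FA Q). cls Q p \<in> J}"
    then show "p + q \<in> {p \<in> carrier (FA Q). cls Q p \<in> J}"
      using additive_subgroup.a_closed[OF J.is_additive_subgroup, of "cls Q p" "cls Q q"]
      by (simp add: add_closed cls_add)
  next
    fix p q assume "p \<in> {p \<in> carrier (FA Q). cls Q p \<in> J}" "q \<in> carrier (FA Q)"
    then show "q * p \<in> {p \<in> carrier (FA Q). cls Q p \<in> J}" "p * q \<in> {p \<in> carrier (FA Q). cls Q p \<in> J}"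
      using J.I_l_closed[of "cls Q p" "cls Q q"] J.I_r_closed[of "cls Q p" "cls Q q"]
      by (simp_all add: mult_closed cls_mult cls_in)
  qed auto
qed

text \<open>The integer degree \<open>- 2 * k - m\<close> of a generator has the same parity as its
  loop number \<open>m\<close>. Hence homogeneous elements have a parity.\<close>

lemma even_word_degree: "even (snd (word_degree Q w)) \<longleftrightarrow> word_par Q w = 0"
proof -
  have "even (snd (\<Sum>x\<leftarrow>xs. gen_degree Q x)) \<longleftrightarrow> even (\<Sum>x\<leftarrow>xs. gen_par Q x)" for xs
    by (induction xs) (auto simp: gen_degree_def gen_par_def split: prod.splits)
  then show ?thesis by (simp add: word_degree_def word_par_def even_iff_mod_2_eq_zero)
qed

lemma homogeneous_has_parity: "homogeneous Q f \<Longrightarrow> has_parity Q 0 f \<or> has_parity Q 1 f"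
proof -
  assume "homogeneous Q f"
  then obtain d p where p: "p \<in> carrier (FA Q)" "f = cls Q p" "\<forall>w \<in> Poly_Mapping.keys p. word_degree Q w = d"
    by (auto simp: homogeneous_def has_degree_def)
  have "word_par Q w = 0 \<or> word_par Q w = 1" for w by (auto simp: word_par_def)
  with p(3) have "\<forall>w \<in> Poly_Mapping.keys p. word_par Q w = (if even (snd d) then 0 else 1)"
    by (metis even_word_degree)
  with p show ?thesis unfolding has_parity_def by (cases "even (snd d)") auto
qed

text \<open>A consequence shared by both parities: what \<open>f\<close> kills in the quotient is a
  multiple of \<open>f\<close> there. In the even case the multiple is zero.\<close>

lemma regular_onD:
  assumes "ideal J (R\<^sub>Q Q)" "regular_on Q (quotient_module (R\<^sub>Q Q) J) f"
    and "f \<in> carrier (R\<^sub>Q Q)" "x \<in> carrier (R\<^sub>Q Q)" "f \<otimes>\<^bsub>R\<^sub>Q Q\<^esub> x \<in> J"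
  shows "\<exists>y \<in> carrier (R\<^sub>Q Q). x \<ominus>\<^bsub>R\<^sub>Q Q\<^esub> f \<otimes>\<^bsub>R\<^sub>Q Q\<^esub> y \<in> J"
proof -
  interpret J: ideal J "R\<^sub>Q Q" by fact
  consider "has_parity Q 0 f" | "has_parity Q 1 f"
    using assms(2) homogeneous_has_parity by (auto simp: regular_on_def)
  then show ?thesis
  proof cases
    case 1
    with assms(2) have "inj_on (\<lambda>x. f \<odot>\<^bsub>quotient_module (R\<^sub>Q Q) J\<^esub> x) (carrier (quotient_module (R\<^sub>Q Q) J))"
      unfolding regular_on_def by blast
    then have "x \<in> J"
      unfolding J.inj_on_quotient_module_iff[OF assms(3)] using assms(4,5) by blast
    then show ?thesis
      using assms(3,4) by (intro bexI[of _ "\<zero>\<^bsub>R\<^sub>Q Q\<^esub>"]) (simp_all add: a_minus_def)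
  next
    case 2
    with assms(2) show ?thesis
      by (intro J.a_kernel_quotient_moduleD[OF _ assms(3-5)]) (simp add: regular_on_def)
  qed
qed

text \<open>The last coefficient goes first: regularity writes \<open>l n\<close> as a multiple of
  \<open>f n\<close> modulo the earlier relations, all of length at least two. Hence
  \<open>l n\<close> is zero and the syzygy gets shorter. Coefficients beyond \<open>N\<close> are
  zero, so \<open>n\<close> may exceed the length of the sequence.\<close>

lemma regular_no_linear_syzygy:
  assumes reg: "regular_sequence Q N f"
    and f: "\<And>m. enat m < N \<Longrightarrow> f m = cls Q (g m) \<and> g m \<in> long_polys (gens Q)"
    and l: "\<And>j. l j \<in> carrier (FA Q)" "\<And>j w. w \<in> Poly_Mapping.keys (l j) \<Longrightarrow> length (letters w) = 1"
    and l0: "\<And>j. \<not> enat j < N \<Longrightarrow> l j = 0"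
    and syz: "(\<Sum>j<n. g j * l j) \<in> supercomm_ideal (gens Q) (gen_par Q)"
    and "j < n"
  shows "l j = 0"
  using syz \<open>j < n\<close>
proof (induction n arbitrary: j)
  case (Suc n)
  have g: "g m \<in> carrier (FA Q)" if "enat m < N" for m
    using f[OF that] long_polys_carrier by blast
  interpret RQ: ring "R\<^sub>Q Q" by (rule ring_free_supercomm_algebra)
  have "l n = 0"
  proof (cases "enat n < N")
    case True
    let ?J = "Idl\<^bsub>R\<^sub>Q Q\<^esub> (f ` {..<n})"
    have N: "enat m < N" if "m < n" for m using that True by (meson enat_ord_simps(2) less_trans)
    have sub: "f ` {..<n} \<subseteq> carrier (R\<^sub>Q Q)" using f N g by (auto simp: cls_in)
    have J: "ideal ?J (R\<^sub>Q Q)" by (rule RQ.genideal_ideal[OF sub])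
    note pre = ideal_cls_preimage[OF J]
    note sp = subspace_ideal[OF pre]
    interpret J: ideal ?J "R\<^sub>Q Q" by fact
    have Jlong: "?J \<subseteq> cls Q ` long_polys (gens Q)"
      by (rule RQ.genideal_minimal[OF ideal_cls_image[OF ideal_long_polys]]) (use f N in auto)
    have "g m * l m \<in> {p \<in> carrier (FA Q). cls Q p \<in> ?J}" if "m < n" for m
    proof -
      have "f m \<in> ?J" using RQ.genideal_self[OF sub] that by auto
      from J.I_r_closed[OF this cls_in[OF l(1)]] show ?thesis
        using f[OF N[OF that]] g[OF N[OF that]] l(1) by (simp add: cls_mult mult_closed)
    qed
    then have "(\<Sum>m<n. g m * l m) \<in> {p \<in> carrier (FA Q). cls Q p \<in> ?J}"
      by (intro vs.subspace_sum[OF sp]) simp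
    then have sumJ: "- (\<Sum>m<n. g m * l m) \<in> {p \<in> carrier (FA Q). cls Q p \<in> ?J}"
      by (rule vs.subspace_neg[OF sp])
    have "cls Q (g n * l n) = cls Q (- (\<Sum>m<n. g m * l m))"
      using Suc.prems(1) sumJ g[OF True] l(1) by (subst cls_eq_iff) (auto simp: mult_closed add.commute)
    with sumJ have "f n \<otimes>\<^bsub>R\<^sub>Q Q\<^esub> cls Q (l n) \<in> ?J"
      using f[OF True] g[OF True] l(1) by (simp add: cls_mult)
    moreover have "regular_on Q (quotient_module (R\<^sub>Q Q) ?J) (f n)"
      using reg True unfolding regular_sequence_def by blast
    moreover have "f n \<in> carrier (R\<^sub>Q Q)" using f[OF True] g[OF True] by (simp add: cls_in)
    ultimately obtain y where
      y: "y \<in> carrier (R\<^sub>Q Q)" "cls Q (l n) \<ominus>\<^bsub>R\<^sub>Q Q\<^esub> f n \<otimes>\<^bsub>R\<^sub>Q Q\<^esub> y \<in> ?J"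
      using regular_onD[OF J _ _ cls_in[OF l(1)]] by blast
    then obtain h where h: "h \<in> carrier (FA Q)" "y = cls Q h" by (auto simp: carrier_RQ)
    have gh: "g n * h \<in> carrier (FA Q)" by (intro mult_closed g h True)
    from y(2) have "cls Q (l n - g n * h) \<in> ?J"
      using f[OF True] g[OF True] h l(1) gh by (simp add: cls_mult cls_minus)
    then obtain q where q: "q \<in> long_polys (gens Q)" "cls Q (l n - g n * h) = cls Q q"
      using Jlong by blast
    then have "l n - g n * h - q \<in> supercomm_ideal (gens Q) (gen_par Q)"
      using cls_eq_iff[OF diff_closed[OF l(1) gh]] long_polys_carrier by blast
    \<comment> \<open>All three summands of \<open>l n\<close> start in length two, whereas
      \<open>l n\<close> has only words of length one.\<close>
    from supercomm_ideal_long[OF this] have "(l n - g n * h - q) + q + g n * h \<in> long_polys (gens Q)"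
      using ideal.I_r_closed[OF ideal_long_polys _ h(1), of "g n"] f[OF True] q(1)
      by (intro vs.subspace_add[OF subspace_long_polys]) (simp_all add: free_algebra_ops)
    then have "l n \<in> long_polys (gens Q)" by simp
    then have "Poly_Mapping.keys (l n) = {}" using l(2)[of _ n] by (fastforce simp: long_polys_def)
    then show ?thesis by simp
  qed (rule l0)
  moreover from this Suc.prems(1) have "j' < n \<Longrightarrow> l j' = 0" for j' using Suc.IH by simp
  ultimately show ?case using Suc.prems(2) by (auto simp: less_Suc_eq)
qed simp

text \<open>The coefficients are padded by zeros and the formula holds for all large
  \<open>m\<close>, so that two combinations can be brought to a common length.\<close>

lemma span_image_sum:
  fixes g :: "nat \<Rightarrow> 'g word \<Rightarrow>\<^sub>0 rat"
  assumes "p \<in> vs.span (g ` A)"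
  shows "\<exists>n c. (\<forall>j. j \<notin> A \<longrightarrow> c j = 0) \<and> (\<forall>m\<ge>n. p = (\<Sum>j<m. const (c j) * g j))"
  using assms
proof (induction rule: vs.span_induct_alt)
  case base
  show ?case by (intro exI[of _ "\<lambda>_. 0"] exI[of _ 0]) simp
next
  case (step a x y)
  from step(1) obtain k where k: "k \<in> A" "x = g k" by blast
  from step(2) obtain n c where c: "\<forall>j. j \<notin> A \<longrightarrow> c j = 0" "\<forall>m\<ge>n. y = (\<Sum>j<m. const (c j) * g j)" by blast
  define d where "d j = c j + (if j = k then a else 0)" for j
  have "const a * x + y = (\<Sum>j<m. const (d j) * g j)" if "m \<ge> max n (Suc k)" for m
  proof -
    have "(\<Sum>j<m. const (d j) * g j) = (\<Sum>j<m. const (c j) * g j) + (\<Sum>j<m. if j = k then const a * g k else 0)"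
      unfolding sum.distrib[symmetric] by (intro sum.cong) (auto simp: d_def const_add distrib_right)
    also have "\<dots> = const a * x + y" using c(2)[rule_format, of m] that k(2) by simp
    finally show ?thesis ..
  qed
  moreover have "\<forall>j. j \<notin> A \<longrightarrow> d j = 0" using c(1) k(1) by (auto simp: d_def)
  ultimately show ?case by blast
qed

text \<open>Arbitrary representatives first identify the span of the sequence. They are then
  replaced by representatives inside the span of the quadratic polynomials, which start in length
  two.\<close>

lemma minimal_relations_reps:
  assumes "minimal_relations Q N f"
  obtains g where "\<And>n. enat n < N \<Longrightarrow> f n = cls Q (g n)"
    and "\<And>n. enat n < N \<Longrightarrow> g n \<in> vs.span (quad_polys Q)"
    and "cls Q ` vs.span (g ` {n. enat n < N}) = cls Q ` vs.span (quad_polys Q)"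
proof -
  let ?A = "{n. enat n < N}"
  have hom: "homogeneous Q (f n)" if "n \<in> ?A" for n using assms that by (auto simp: minimal_relations_def)
  have span: "linear_span Q (f ` ?A) = cls Q ` vs.span (quad_polys Q)"
    using assms linear_span_cls[of "quad_polys Q" Q] quad_polys_long[of Q] long_polys_carrier[of "gens Q"]
    by (auto simp: minimal_relations_def quad_relations_eq)
  define g' where "g' n = (SOME p. p \<in> carrier (FA Q) \<and> f n = cls Q p)" for n
  have g': "g' n \<in> carrier (FA Q)" "f n = cls Q (g' n)" if "n \<in> ?A" for n
    using someI_ex[of "\<lambda>p. p \<in> carrier (FA Q) \<and> f n = cls Q p"] hom[OF that]
    unfolding g'_def homogeneous_def has_degree_def by blast+
  have "f ` ?A = cls Q ` g' ` ?A" unfolding image_image using g' by (intro image_cong) auto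
  then have "linear_span Q (f ` ?A) = cls Q ` vs.span (g' ` ?A)"
    using linear_span_cls[of "g' ` ?A" Q] g'(1) by (simp only:) blast
  with span have span': "cls Q ` vs.span (quad_polys Q) = cls Q ` vs.span (g' ` ?A)" by (rule trans[OF sym])
  have "f n \<in> cls Q ` vs.span (quad_polys Q)" if "n \<in> ?A" for n
    unfolding g'(2)[OF that] span' using that by (intro imageI vs.span_base)
  then have "\<forall>n. \<exists>p. n \<in> ?A \<longrightarrow> f n = cls Q p \<and> p \<in> vs.span (quad_polys Q)" by blast
  then obtain g where g: "\<And>n. n \<in> ?A \<Longrightarrow> f n = cls Q (g n) \<and> g n \<in> vs.span (quad_polys Q)"
    by metis
  have sub: "g ` ?A \<subseteq> carrier (FA Q)" using g span_quad_polys_carrier[of Q] by blast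
  have "f ` ?A = cls Q ` g ` ?A" unfolding image_image using g by (intro image_cong) auto
  then have "linear_span Q (f ` ?A) = cls Q ` vs.span (g ` ?A)"
    using linear_span_cls[OF sub] by (rule ssubst)
  with g span that[of g] show thesis by simp
qed

lemma regular_syzygy:
  assumes min: "minimal_relations Q N f" and reg: "regular_sequence Q N f"
    and rs: "r \<in> vs.span (quad_polys Q)" "s \<in> vs.span (quad_polys Q)"
    and xy: "x \<in> gens Q" "y \<in> gens Q" "x \<noteq> y"
    and syz: "r * gen x - s * gen y \<in> supercomm_ideal (gens Q) (gen_par Q)"
  shows "r \<in> supercomm_ideal (gens Q) (gen_par Q)"
proof -
  let ?A = "{n. enat n < N}" and ?I = "supercomm_ideal (gens Q) (gen_par Q)"
  obtain g where
    g: "\<And>n. n \<in> ?A \<Longrightarrow> f n = cls Q (g n)" "\<And>n. n \<in> ?A \<Longrightarrow> g n \<in> vs.span (quad_polys Q)"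
    and span: "cls Q ` vs.span (g ` ?A) = cls Q ` vs.span (quad_polys Q)"
    by (rule minimal_relations_reps[OF min]) simp
  have long: "g n \<in> long_polys (gens Q)" if "n \<in> ?A" for n
    using g(2)[OF that] span_quad_polys_long by blast
  have gA: "vs.span (g ` ?A) \<subseteq> carrier (FA Q)"
    using g(2) span_quad_polys_carrier by (intro span_carrier) blast
  have "\<exists>n c. (\<forall>j. j \<notin> ?A \<longrightarrow> c j = 0) \<and> (\<forall>m\<ge>n. r - (\<Sum>j<m. const (c j) * g j) \<in> ?I)"
    if "r \<in> vs.span (quad_polys Q)" for r
  proof -
    from that span obtain r' where r': "cls Q r = cls Q r'" "r' \<in> vs.span (g ` ?A)" by blast
    have "r \<in> carrier (FA Q)" "r' \<in> carrier (FA Q)"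
      using that r'(2) gA span_quad_polys_carrier[of Q] by auto
    with r'(1) have "r - r' \<in> ?I" using cls_eq_iff by blast
    moreover obtain n c where "\<forall>j. j \<notin> ?A \<longrightarrow> c j = 0" "\<forall>m\<ge>n. r' = (\<Sum>j<m. const (c j) * g j)"
      using span_image_sum[OF r'(2)] by blast
    ultimately show ?thesis by auto
  qed
  from this[OF rs(1)] this[OF rs(2)] obtain n1 c n2 d where
    c: "\<And>j. j \<notin> ?A \<Longrightarrow> c j = 0" "\<And>m. m \<ge> n1 \<Longrightarrow> r - (\<Sum>j<m. const (c j) * g j) \<in> ?I" and
    d: "\<And>j. j \<notin> ?A \<Longrightarrow> d j = 0" "\<And>m. m \<ge> n2 \<Longrightarrow> s - (\<Sum>j<m. const (d j) * g j) \<in> ?I" by blast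
  define m where "m = max n1 n2"
  \<comment> \<open>Expanding \<open>r\<close> and \<open>s\<close> in the basis turns the syzygy
    into one with these linear coefficients; as \<open>x\<close> and \<open>y\<close> differ,
    \<open>l j = 0\<close> forces \<open>c j = 0\<close>.\<close>
  define l where "l j = const (c j) * gen x - const (d j) * gen y" for j
  have l: "l j = Poly_Mapping.single (Word [x]) (c j) - Poly_Mapping.single (Word [y]) (d j)" for j
    by (simp add: l_def gen_def const_def mult_single plus_word_def zero_word_def)
  have "(\<Sum>j<m. g j * l j) = (\<Sum>j<m. const (c j) * g j) * gen x - (\<Sum>j<m. const (d j) * g j) * gen y"
    by (simp add: l_def right_diff_distrib sum_subtractf sum_distrib_right mult_const flip: mult.assoc)
  also have "\<dots> = (r * gen x - s * gen y) - (r - (\<Sum>j<m. const (c j) * g j)) * gen x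
      + (s - (\<Sum>j<m. const (d j) * g j)) * gen y"
    by (simp add: left_diff_distrib)
  also have "\<dots> \<in> ?I"
    using c(2)[of m] d(2)[of m] unfolding m_def
    by (intro supercomm_ideal_add[OF supercomm_ideal_diff[OF syz supercomm_ideal_mult_right[OF _ gen_closed]]
        supercomm_ideal_mult_right[OF _ gen_closed]] xy) simp_all
  finally have sum_l: "(\<Sum>j<m. g j * l j) \<in> ?I" .
  have "l j = 0" if "j < m" for j
  proof (rule regular_no_linear_syzygy[OF reg _ _ _ _ sum_l that])
    show "l j \<in> carrier (FA Q)" for j
      unfolding l_def by (intro diff_closed mult_closed const_closed gen_closed xy)
    show "length (letters w) = 1" if "w \<in> Poly_Mapping.keys (l j)" for j w
      using that by (auto simp: l in_keys_iff lookup_minus lookup_single when_def split: if_splits)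
    show "l j = 0" if "\<not> enat j < N" for j
      using c(1)[of j] d(1)[of j] that by (simp add: l_def)
  qed (use g long that in auto)
  moreover have "c j = Poly_Mapping.lookup (l j) (Word [x])" for j
    using xy(3) by (simp add: l lookup_minus lookup_single)
  ultimately have "(\<Sum>j<m. const (c j) * g j) = 0" by simp
  with c(2)[of m] show ?thesis by (simp add: m_def)
qed


text \<open>Each clause exhibits a linear syzygy in R whose first relation is nonzero by
  \<open>gen_mult_notin\<close>. The second clause for \<open>i = j\<close> and the third together
  exclude two or more loops at a vertex.\<close>

lemma regular_arrow_conditions:
  assumes min: "minimal_relations Q N f" and reg: "regular_sequence Q N f" and sym: "symmetric_quiver Q"
  shows regular_arrow_even_loops:
      "\<And>i j. i \<in> verts Q \<Longrightarrow> j \<in> verts Q \<Longrightarrow> i \<noteq> j \<Longrightarrow> 0 < num_arrows Q i j \<Longrightarrow> even (num_arrows Q j j)"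
    and regular_two_arrows_odd_loops:
      "\<And>i j. i \<in> verts Q \<Longrightarrow> j \<in> verts Q \<Longrightarrow> 2 \<le> num_arrows Q i j \<Longrightarrow> odd (num_arrows Q j j)"
    and regular_two_loops_even:
      "\<And>i. i \<in> verts Q \<Longrightarrow> 2 \<le> num_arrows Q i i \<Longrightarrow> even (num_arrows Q i i)"
    and regular_no_path:
      "\<And>i j k. i \<in> verts Q \<Longrightarrow> j \<in> verts Q \<Longrightarrow> k \<in> verts Q \<Longrightarrow> distinct [i, j, k] \<Longrightarrow>
        0 < num_arrows Q i j \<Longrightarrow> 0 < num_arrows Q j k \<Longrightarrow> False"
proof -
  let ?I = "supercomm_ideal (gens Q) (gen_par Q)"
  note syz = regular_syzygy[OF min reg]
  have in0: "gen (i, 0) * gen (j, 0) \<in> vs.span (quad_polys Q)"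
    if "i \<in> verts Q" "j \<in> verts Q" "0 < num_arrows Q i j" for i j
    using that by (intro vs.span_base) (auto simp: quad_polys_def simp flip: quad_poly_0)
  have in1: "gen (i, 0) * gen (j, 1) \<in> vs.span (quad_polys Q)"
    if "i \<in> verts Q" "j \<in> verts Q" "2 \<le> num_arrows Q i j" for i j
  proof -
    have "quad_poly i j 1 1 \<in> quad_polys Q"
      unfolding quad_polys_def using that by (intro CollectI exI[of _ i] exI[of _ j] exI[of _ 1]) simp
    from vs.span_base[OF this] show ?thesis by (simp only: quad_poly_1)
  qed
  have gens: "(i, k) \<in> gens Q" if "i \<in> verts Q" for i k using that by (simp add: gens_def)
  have par: "gen_par Q (i, k) = num_arrows Q i i" for i k by (simp add: gen_par_def)
  show even_loops: "even (num_arrows Q j j)"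
    if ij: "i \<in> verts Q" "j \<in> verts Q" "i \<noteq> j" "0 < num_arrows Q i j" for i j
  proof (rule ccontr)
    assume odd: "odd (num_arrows Q j j)"
    have "gen (i, 0) * (gen (j, 0) * gen (j, 0)) \<in> ?I"
      using ij odd by (intro supercomm_ideal_mult_left odd_square_in gen_in gens) (simp_all add: par)
    \<comment> \<open>Here \<open>s = 0\<close>, and \<open>(j, 1)\<close> is taken as a second
      generator different from \<open>(j, 0)\<close>.\<close>
    then have "gen (i, 0) * gen (j, 0) \<in> ?I"
      using syz[OF in0[OF ij(1,2,4)] vs.span_zero gens[OF ij(2), of 0] gens[OF ij(2), of 1]]
      by (simp add: mult.assoc)
    moreover have "gen (i, 0) * gen (j, 0) \<notin> ?I" using ij(3) by (intro gen_mult_notin) simp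
    ultimately show False by blast
  qed
  show "odd (num_arrows Q j j)" if ij: "i \<in> verts Q" "j \<in> verts Q" "2 \<le> num_arrows Q i j" for i j
  proof
    assume even: "even (num_arrows Q j j)"
    have "gen (i, 0) * (gen (j, 0) * gen (j, 1) - gen (j, 1) * gen (j, 0)) \<in> ?I"
      using ij even by (intro supercomm_ideal_mult_left even_commute_in gen_in gens) (simp_all add: par)
    then have "gen (i, 0) * gen (j, 0) \<in> ?I"
      using syz[OF in0 in1 gens[OF ij(2), of 1] gens[OF ij(2), of 0], of i j i j] ij
      by (simp add: right_diff_distrib mult.assoc)
    moreover have "gen (i, 0) * gen (j, 0) \<notin> ?I" using even by (intro gen_mult_notin) (auto simp: par)
    ultimately show False by blast
  qed
  show "even (num_arrows Q i i)" if i: "i \<in> verts Q" "2 \<le> num_arrows Q i i" for i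
  proof (rule ccontr)
    assume odd: "odd (num_arrows Q i i)"
    \<comment> \<open>The square of \<open>a_{i,0}\<close> is already zero in R, so the relation
      used is \<open>a_{i,0} a_{i,1}\<close>, which comes from \<open>p = 1\<close>.\<close>
    have "gen (i, 0) * (gen (i, 1) * gen (i, 1)) \<in> ?I"
      using i odd by (intro supercomm_ideal_mult_left odd_square_in gen_in gens) (simp_all add: par)
    then have "gen (i, 0) * gen (i, 1) \<in> ?I"
      using syz[OF in1[OF i(1,1,2)] vs.span_zero gens[OF i(1), of 1] gens[OF i(1), of 0]]
      by (simp add: mult.assoc)
    moreover have "gen (i, 0) * gen (i, 1) \<notin> ?I" by (intro gen_mult_notin) simp
    ultimately show False by blast
  qed
  show False if ijk: "i \<in> verts Q" "j \<in> verts Q" "k \<in> verts Q" "distinct [i, j, k]"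
    "0 < num_arrows Q i j" "0 < num_arrows Q j k" for i j k
  proof -
    have s: "0 < num_arrows Q k j" "0 < num_arrows Q j i"
      using ijk sym by (auto simp: symmetric_quiver_def)
    have even: "even (num_arrows Q i i)" "even (num_arrows Q j j)" "even (num_arrows Q k k)"
      using even_loops[of j i] even_loops[of i j] even_loops[of j k] ijk s by auto
    let ?a = "gen (i, 0)" and ?b = "gen (j, 0)" and ?c = "gen (k, 0)"
    \<comment> \<open>Three commutators telescope from the word \<open>a b c\<close> to the word
      \<open>c b a\<close>.\<close>
    have "?a * (?b * ?c - ?c * ?b) + (?a * ?c - ?c * ?a) * ?b + ?c * (?a * ?b - ?b * ?a) \<in> ?I"
      using ijk even
      by (intro supercomm_ideal_add supercomm_ideal_mult_left supercomm_ideal_mult_right even_commute_in gen_in gens)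
         (simp_all add: par)
    also have "?a * (?b * ?c - ?c * ?b) + (?a * ?c - ?c * ?a) * ?b + ?c * (?a * ?b - ?b * ?a)
        = (?a * ?b) * ?c - (?c * ?b) * ?a"
      by (simp add: algebra_simps)
    finally have "?a * ?b \<in> ?I"
      using syz[OF in0[OF ijk(1,2,5)] in0[OF ijk(3,2) s(1)] gens[OF ijk(3), of 0] gens[OF ijk(1), of 0]] ijk(4)
      by (simp add: eq_commute[of k])
    moreover have "?a * ?b \<notin> ?I" using ijk(4) by (intro gen_mult_notin) simp
    ultimately show False by blast
  qed
qed

section \<open>Connected quivers that satisfy the arrow conditions\<close>

lemma connected_closed_verts:
  assumes "fin_digraph Q" "Digraph_Component.connected Q" "u \<in> verts Q" "u \<in> S"
    and "\<And>x y. x \<in> S \<Longrightarrow> x \<in> verts Q \<Longrightarrow> y \<in> verts Q \<Longrightarrow> 0 < num_arrows Q x y \<or> 0 < num_arrows Q y x \<Longrightarrow> y \<in> S"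
  shows "verts Q \<subseteq> S"
proof
  interpret fin_digraph Q by fact
  \<comment> \<open>Connectedness is reachability in the symmetrized digraph, so closure under
    arrows in both directions is what the induction along a path needs.\<close>
  interpret S: pair_wf_digraph "mk_symmetric Q" by (rule wellformed_mk_symmetric)
  have pos: "0 < num_arrows Q (tail Q e) (head Q e)" if "e \<in> arcs Q" for e
    using that finite_arcs by (auto simp: num_arrows_def card_gt_0_iff)
  fix v assume "v \<in> verts Q"
  then have "u \<rightarrow>\<^sup>*\<^bsub>mk_symmetric Q\<^esub> v"
    using assms(2,3) by (auto simp: Digraph_Component.connected_def strongly_connected_def)
  then show "v \<in> S"
  proof (induction rule: S.reachable_induct)
    case (step x y)
    then obtain e where e: "e \<in> arcs Q" "(x, y) = (tail Q e, head Q e) \<or> (x, y) = (head Q e, tail Q e)"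
      by (auto simp: parcs_mk_symmetric)
    with pos[OF e(1)] step.IH show ?case by (intro assms(5)[of x y]) auto
  qed (rule assms(4))
qed

lemma regular_imp_small_quiver:
  assumes fin: "fin_digraph Q" and conn: "Digraph_Component.connected Q" and sym: "symmetric_quiver Q"
    and min: "minimal_relations Q N f" and reg: "regular_sequence Q N f"
  shows "(\<exists>u. verts Q = {u} \<and> arcs Q = {})
    \<or> (\<exists>u e. verts Q = {u} \<and> arcs Q = {e})
    \<or> (\<exists>u v e e'. u \<noteq> v \<and> e \<noteq> e' \<and> verts Q = {u, v} \<and> arcs Q = {e, e'} \<and>
         tail Q e = u \<and> head Q e = v \<and> tail Q e' = v \<and> head Q e' = u)"
proof -
  interpret fin_digraph Q by fact
  note cond = regular_arrow_conditions[OF min reg sym]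
  have sym': "num_arrows Q i j = num_arrows Q j i" if "i \<in> verts Q" "j \<in> verts Q" for i j
    using sym that by (auto simp: symmetric_quiver_def)
  have loops: "num_arrows Q i i \<le> 1" if "i \<in> verts Q" for i
    using cond(2)[OF that that] cond(3)[OF that] by force
  from conn obtain u where u: "u \<in> verts Q"
    by (auto simp: Digraph_Component.connected_def strongly_connected_def)
  show ?thesis
  proof (cases "\<exists>v \<in> verts Q. v \<noteq> u \<and> 0 < num_arrows Q u v")
    case False
    have "verts Q \<subseteq> {u}"
      by (rule connected_closed_verts[OF fin conn u]) (use False sym' in auto)
    with u have verts: "verts Q = {u}" by auto
    then have "arcs Q = {e \<in> arcs Q. tail Q e = u \<and> head Q e = u}" using wellformed by auto
    then have "card (arcs Q) \<le> 1" using loops[OF u] by (simp add: num_arrows_def)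
    then have "arcs Q = {} \<or> (\<exists>e. arcs Q = {e})"
      using finite_arcs by (metis card_0_eq card_1_singletonE le_less less_one)
    with verts show ?thesis by blast
  next
    case True
    then obtain v where v: "v \<in> verts Q" "v \<noteq> u" "0 < num_arrows Q u v" by blast
    have vu: "0 < num_arrows Q v u" using v sym'[OF u v(1)] by simp
    \<comment> \<open>A third vertex adjacent to \<open>u\<close> or \<open>v\<close> would complete
      a path of length two.\<close>
    have "verts Q \<subseteq> {u, v}"
    proof (rule connected_closed_verts[OF fin conn u])
      fix x y assume xy: "x \<in> {u, v}" "x \<in> verts Q" "y \<in> verts Q" "0 < num_arrows Q x y \<or> 0 < num_arrows Q y x"
      then have "0 < num_arrows Q x y" using sym' by metis
      with xy cond(4)[of v u y] cond(4)[of u v y] u v vu show "y \<in> {u, v}" by auto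
    qed simp
    with u v have verts: "verts Q = {u, v}" by auto
    have even: "even (num_arrows Q v v)" "even (num_arrows Q u u)"
      using cond(1)[OF u v(1) _ v(3)] cond(1)[OF v(1) u v(2) vu] v(2) by auto
    then have "num_arrows Q v v = 0" "num_arrows Q u u = 0"
      using loops[OF u] loops[OF v(1)] by (auto simp: le_Suc_eq)
    then have no_loop: "{e \<in> arcs Q. tail Q e = v \<and> head Q e = v} = {}" "{e \<in> arcs Q. tail Q e = u \<and> head Q e = u} = {}"
      using finite_arcs by (simp_all add: num_arrows_def)
    \<comment> \<open>Two parallel arrows would force an odd loop number, but both loop numbers are
      even.\<close>
    have "num_arrows Q u v = 1" "num_arrows Q v u = 1"
      using cond(2)[OF u v(1)] cond(2)[OF v(1) u] even v(3) vu by force+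
    then obtain e e' where e: "{e \<in> arcs Q. tail Q e = u \<and> head Q e = v} = {e}"
      "{e \<in> arcs Q. tail Q e = v \<and> head Q e = u} = {e'}"
      unfolding num_arrows_def by (elim card_1_singletonE) simp
    then have ends: "e \<in> arcs Q" "tail Q e = u" "head Q e = v" "e' \<in> arcs Q" "tail Q e' = v" "head Q e' = u"
      by blast+
    have "x \<in> {e, e'}" if "x \<in> arcs Q" for x
    proof -
      have "tail Q x \<in> {u, v}" "head Q x \<in> {u, v}" using that wellformed verts by auto
      with that e no_loop show ?thesis by blast
    qed
    with ends have "arcs Q = {e, e'}" by auto
    with ends verts v(2) show ?thesis by metis
  qed
qed

subsection \<open>Sufficiency\<close>

definition push :: "('a \<Rightarrow> 'b) \<Rightarrow> ('a \<Rightarrow>\<^sub>0 rat) \<Rightarrow> ('b \<Rightarrow>\<^sub>0 rat)" where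
  "push h p = (\<Sum>w\<in>Poly_Mapping.keys p. Poly_Mapping.single (h w) (Poly_Mapping.lookup p w))"

lemma push_superset:
  assumes "finite A" "Poly_Mapping.keys p \<subseteq> A"
  shows "push h p = (\<Sum>w\<in>A. Poly_Mapping.single (h w) (Poly_Mapping.lookup p w))"
  unfolding push_def using assms by (intro sum.mono_neutral_left) (auto simp: in_keys_iff)

lemma push_add: "push h (p + q) = push h p + push h q"
proof -
  let ?A = "Poly_Mapping.keys p \<union> Poly_Mapping.keys q"
  have "push h r = (\<Sum>w\<in>?A. Poly_Mapping.single (h w) (Poly_Mapping.lookup r w))"
    if "Poly_Mapping.keys r \<subseteq> ?A" for r
    using that by (intro push_superset) auto
  then show ?thesis
    using Poly_Mapping.keys_add[of p q] by (simp add: lookup_add single_add sum.distrib)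
qed

lemma push_0 [simp]: "push h 0 = 0"
  by (simp add: push_def)

lemma push_single [simp]: "push h (Poly_Mapping.single w c) = Poly_Mapping.single (h w) c"
  by (cases "c = 0") (simp_all add: push_def)

lemma push_uminus: "push h (- p) = - push h p"
  using push_add[of h p "- p"] by (simp add: eq_neg_iff_add_eq_0 add.commute)

lemma push_diff: "push h (p - q) = push h p - push h q"
  using push_add[of h p "- q"] by (simp add: push_uminus)

lemma push_sum: "push h (sum f A) = (\<Sum>i\<in>A. push h (f i))"
  by (induction A rule: infinite_finite_induct) (simp_all add: push_add)

lemma push_push: "push h (push h' p) = push (h \<circ> h') p"
  by (induction p rule: poly_mapping_single_induct) (simp_all add: push_add)

lemma keys_push: "Poly_Mapping.keys (push h p) \<subseteq> h ` Poly_Mapping.keys p"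
  unfolding push_def using keys_sum by (fastforce split: if_splits)

lemma push_cong: "(\<And>w. w \<in> Poly_Mapping.keys p \<Longrightarrow> h w = h' w) \<Longrightarrow> push h p = push h' p"
  by (simp add: push_def)

lemma push_id: "push (\<lambda>w. w) p = p"
  by (induction p rule: poly_mapping_single_induct) (simp_all add: push_add)

text \<open>For additive \<open>h\<close> the linear extension is a homomorphism of monoid algebras;
  this covers \<open>abel\<close>.\<close>

lemma push_mult:
  assumes "\<And>v w. h (v + w) = h v + h w"
  shows "push h (p * q) = push h p * push h q"
proof -
  have "push h (Poly_Mapping.single w c * q) = Poly_Mapping.single (h w) c * push h q" for w c
    by (induction q rule: poly_mapping_single_induct) (simp_all add: distrib_left push_add mult_single assms)
  then show ?thesis
    by (induction p rule: poly_mapping_single_induct) (simp_all add: distrib_right push_add)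
qed

lemma single_mult_gen: "gen x * Poly_Mapping.single (Word xs) 1 = Poly_Mapping.single (Word (x # xs)) 1"
  by (simp add: gen_def mult_single plus_word_def)

definition abel :: "('g \<Rightarrow> 'x) \<Rightarrow> ('g word \<Rightarrow>\<^sub>0 rat) \<Rightarrow> 'x mpoly" where
  "abel h = push (\<lambda>w. mset (map h (letters w)))"

lemma abel_mult: "abel h (p * q) = abel h p * abel h q"
  unfolding abel_def by (rule push_mult) (simp add: plus_word_def)

lemma abel_gen: "abel h (gen x) = var (h x)"
  by (simp add: abel_def gen_def var_def)

lemma abel_const: "abel h (const c) = Poly_Mapping.single 0 c"
  by (simp add: abel_def const_def zero_word_def)

lemma abel_add: "abel h (p + q) = abel h p + abel h q"
  by (simp add: abel_def push_add)

lemma abel_0: "abel h 0 = 0"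
  by (simp add: abel_def)

lemma ideal_abel_preimage: "ideal {p \<in> carrier (free_algebra X). abel h p \<in> idl.span S} (free_algebra X)"
proof (rule idealI_free_algebra)
  fix p q
  assume "p \<in> {p \<in> carrier (free_algebra X). abel h p \<in> idl.span S}" "q \<in> carrier (free_algebra X)"
  moreover from this have "abel h q * abel h p \<in> idl.span S" by (intro idl.span_scale) simp
  ultimately show "q * p \<in> {p \<in> carrier (free_algebra X). abel h p \<in> idl.span S}"
    "p * q \<in> {p \<in> carrier (free_algebra X). abel h p \<in> idl.span S}"
    by (simp_all add: mult_closed abel_mult mult.commute[of "abel h p"])
qed (auto simp: zero_closed add_closed abel_add abel_0 intro: idl.span_zero idl.span_add)

lemma mset_SOME: "mset (SOME xs. mset xs = m) = m"
  by (rule someI_ex) (rule ex_mset)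

context
  fixes X :: "'g set" and par :: "'g \<Rightarrow> nat"
  assumes even: "\<And>x. x \<in> X \<Longrightarrow> even (par x)"
begin

lemma word_in: "set xs \<subseteq> X \<Longrightarrow> Poly_Mapping.single (Word xs) 1 \<in> carrier (free_algebra X)"
  by (simp add: carrier_free_algebra_iff)

lemma supercomm_ideal_move:
  assumes "x \<in> X" "set xs \<subseteq> X" "set ys \<subseteq> X"
  shows "Poly_Mapping.single (Word (x # xs @ ys)) 1 - Poly_Mapping.single (Word (xs @ x # ys)) 1
    \<in> supercomm_ideal X par"
  using assms(2)
proof (induction xs)
  case Nil
  then show ?case by (simp add: supercomm_ideal_zero)
next
  case (Cons z xs)
  have "(gen x * gen z - gen z * gen x) * Poly_Mapping.single (Word (xs @ ys)) 1
      + gen z * (Poly_Mapping.single (Word (x # xs @ ys)) 1 - Poly_Mapping.single (Word (xs @ x # ys)) 1)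
      \<in> supercomm_ideal X par"
    using Cons assms even
    by (intro supercomm_ideal_add supercomm_ideal_mult_right supercomm_ideal_mult_left even_commute_in word_in gen_closed) auto
  then show ?case by (simp add: left_diff_distrib right_diff_distrib mult.assoc single_mult_gen)
qed

text \<open>Induction on the word: the tails are matched first, then the leading letter travels to
  its place past the letters before it.\<close>

lemma supercomm_ideal_perm:
  "mset xs = mset ys \<Longrightarrow> set xs \<subseteq> X \<Longrightarrow>
    Poly_Mapping.single (Word xs) 1 - Poly_Mapping.single (Word ys) 1 \<in> supercomm_ideal X par"
proof (induction xs arbitrary: ys)
  case Nil
  then show ?case by (simp add: supercomm_ideal_zero)
next
  case (Cons x xs)
  from Cons.prems(1) have "x \<in> set ys" by (metis list.set_intros(1) set_mset_mset)
  then obtain ys1 ys2 where ys: "ys = ys1 @ x # ys2" by (auto simp: in_set_conv_decomp)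
  have X: "set ys \<subseteq> X" using Cons.prems by (metis set_mset_mset)
  have "gen x * (Poly_Mapping.single (Word xs) 1 - Poly_Mapping.single (Word (ys1 @ ys2)) 1)
     + (Poly_Mapping.single (Word (x # ys1 @ ys2)) 1 - Poly_Mapping.single (Word (ys1 @ x # ys2)) 1)
     \<in> supercomm_ideal X par"
    using Cons.prems X
    by (intro supercomm_ideal_add supercomm_ideal_mult_left Cons.IH supercomm_ideal_move gen_closed) (auto simp: ys)
  then show ?case by (simp add: ys right_diff_distrib single_mult_gen)
qed

text \<open>A linear section of \<open>abel h\<close>, which picks an arbitrary order of the letters
  of each monomial. By \<open>supercomm_ideal_perm\<close> the choice is irrelevant modulo the
  ideal.\<close>

definition unabel :: "('g \<Rightarrow> 'x) \<Rightarrow> 'x mpoly \<Rightarrow> ('g word \<Rightarrow>\<^sub>0 rat)" where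
  "unabel h = push (\<lambda>m. Word (map (inv_into X h) (SOME xs. mset xs = m)))"

lemma abel_supercomm_ideal:
  assumes "p \<in> supercomm_ideal X par"
  shows "abel h p = 0"
proof -
  have *: "idl.span {} = {0 :: 'x mpoly}" by (rule idl.span_empty)
  \<comment> \<open>For the empty set of generators the preimage ideal is the kernel of
    \<open>abel h\<close>.\<close>
  have "supercomm_ideal X par \<subseteq> {p \<in> carrier (free_algebra X). abel h p \<in> idl.span {}}"
    unfolding supercomm_ideal_def
  proof (rule ring.genideal_minimal[OF ring_free_algebra ideal_abel_preimage], rule subsetI)
    fix p assume p: "p \<in> supercommutators X par"
    then obtain x y where "x \<in> X" "p = gen x * gen y - const 1 * gen y * gen x"
      using even by (auto simp: supercommutators_def)
    then have "abel h p = 0"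
      using abel_mult[of h "gen x" "gen y"] abel_mult[of h "gen y" "gen x"]
      by (simp add: abel_def push_diff mult.commute)
    then show "p \<in> {p \<in> carrier (free_algebra X). abel h p \<in> idl.span {}}"
      using subsetD[OF supercommutators_closed p] by (simp add: idl.span_zero)
  qed
  with assms * show ?thesis by auto
qed

context
  fixes h :: "'g \<Rightarrow> 'x"
  assumes h: "bij_betw h X UNIV"
begin

lemma inv_into_h: "inv_into X h y \<in> X" "h (inv_into X h y) = y"
  using h by (auto simp: bij_betw_def inv_into_into f_inv_into_f)

lemma unabel_closed: "unabel h q \<in> carrier (free_algebra X)"
  using keys_push[of "\<lambda>m. Word (map (inv_into X h) (SOME xs. mset xs = m))" q] inv_into_h(1)
  unfolding carrier_free_algebra_iff unabel_def by fastforce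

lemma abel_unabel: "abel h (unabel h q) = q"
proof -
  have "abel h (unabel h q) = push (\<lambda>m. m) q"
    unfolding abel_def unabel_def push_push
    by (rule push_cong) (simp add: comp_def inv_into_h(2) mset_SOME multiset.map_comp)
  then show ?thesis by (simp add: push_id)
qed

text \<open>Term by term, a word is replaced by a reordering of its own letters.\<close>

lemma diff_unabel_abel:
  assumes "p \<in> carrier (free_algebra X)"
  shows "p - unabel h (abel h p) \<in> supercomm_ideal X par"
proof -
  define s where "s w = Word (map (inv_into X h) (SOME xs. mset xs = mset (map h (letters w))))" for w :: "'g word"
  have p: "p = push (\<lambda>w. w) p" by (simp add: push_id)
  have s: "unabel h (abel h p) = push s p"
    by (simp add: abel_def unabel_def push_push comp_def s_def[abs_def])
  have "p - unabel h (abel h p)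
    = (\<Sum>w\<in>Poly_Mapping.keys p. const (Poly_Mapping.lookup p w) * (Poly_Mapping.single w 1 - Poly_Mapping.single (s w) 1))"
    unfolding s by (subst (1) p) (simp add: push_def sum_subtractf right_diff_distrib const_def mult_single)
  also have "\<dots> \<in> supercomm_ideal X par"
  proof (intro supercomm_ideal_sum supercomm_ideal_scale)
    fix w assume "w \<in> Poly_Mapping.keys p"
    then have w: "set (letters w) \<subseteq> X" using assms by (auto simp: carrier_free_algebra_iff)
    have "mset (letters (s w)) = image_mset (inv_into X h) (mset (map h (letters w)))"
      by (simp add: s_def mset_SOME)
    also have "\<dots> = mset (map (\<lambda>x. inv_into X h (h x)) (letters w))"
      by (simp add: multiset.map_comp comp_def)
    also have "map (\<lambda>x. inv_into X h (h x)) (letters w) = letters w"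
      using w h by (intro map_idI) (auto simp: bij_betw_def)
    finally have "Poly_Mapping.single (Word (letters w)) 1 - Poly_Mapping.single (Word (letters (s w))) 1
      \<in> supercomm_ideal X par"
      by (intro supercomm_ideal_perm w) simp
    then show "Poly_Mapping.single w 1 - Poly_Mapping.single (s w) 1 \<in> supercomm_ideal X par" by simp
  qed
  finally show ?thesis .
qed

lemma abel_eq_imp:
  assumes "p \<in> carrier (free_algebra X)" "q \<in> carrier (free_algebra X)" "abel h p = abel h q"
  shows "p - q \<in> supercomm_ideal X par"
proof -
  have "p - unabel h (abel h p) - (q - unabel h (abel h q)) \<in> supercomm_ideal X par"
    by (intro supercomm_ideal_diff diff_unabel_abel assms)
  then show ?thesis using assms(3) by simp
qed

end

end

section \<open>Consequences of linear independence of the minimal relations\<close>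

lemma independent_appendD:
  assumes "ring R"
  shows "ring.independent R K (xs @ ys) \<Longrightarrow> ring.independent R K ys"
proof -
  interpret ring R by fact
  show "independent K (xs @ ys) \<Longrightarrow> independent K ys"
    by (induction xs) (auto elim: independent.cases)
qed

text \<open>Since \<open>independent\<close> builds lists from the front, an entry is compared with
  the later ones. For \<open>m = n\<close> the list is empty and the statement says that
  \<open>f n\<close> is nonzero.\<close>

lemma minimal_relations_not_in_Span:
  assumes "minimal_relations Q N f" "enat n < N" "m \<le> n"
  shows "f m \<notin> ring.Span (R\<^sub>Q Q) (scalars Q) (map f [Suc m..<Suc n])"
proof -
  interpret RQ: ring "R\<^sub>Q Q" by (rule ring_free_supercomm_algebra)
  have "enat (Suc n) \<le> N" using assms(2) by (simp add: Suc_ile_eq)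
  then have "RQ.independent (scalars Q) (map f [0..<Suc n])"
    using assms(1) by (auto simp: minimal_relations_def)
  moreover have "map f [0..<Suc n] = map f [0..<m] @ f m # map f [Suc m..<Suc n]"
    using assms(3) by (metis le_SucI le_imp_less_Suc list.simps(9) map_append upt_add_eq_append le0 le_add_diff_inverse upt_conv_Cons)
  ultimately have "RQ.independent (scalars Q) (f m # map f [Suc m..<Suc n])"
    using independent_appendD[OF ring_free_supercomm_algebra] by metis
  then show ?thesis by (auto elim: RQ.independent.cases)
qed

lemma minimal_relations_nonzero:
  assumes "minimal_relations Q N f" "enat n < N"
  shows "f n \<noteq> cls Q 0"
  using minimal_relations_not_in_Span[OF assms order_refl] Span_cls[of "[]" Q] by auto

lemma minimal_relations_trivial:
  assumes min: "minimal_relations Q N f"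
    and zero: "quad_polys Q \<subseteq> supercomm_ideal (gens Q) (gen_par Q)"
  shows "N = 0"
proof (rule ccontr)
  assume "N \<noteq> 0"
  then have N: "enat 0 < N" by (simp add: zero_enat_def[symmetric])
  obtain g where g: "f 0 = cls Q g" "g \<in> vs.span (quad_polys Q)"
    using minimal_relations_reps[OF min] N by metis
  have "g \<in> supercomm_ideal (gens Q) (gen_par Q)"
    using vs.span_minimal[OF zero subspace_supercomm_ideal] g(2) by blast
  then have "f 0 = cls Q 0"
    using cls_eq_zero_iff[OF supercomm_ideal_carrier, of g Q] unfolding g(1) by (simp add: cls_zero)
  with minimal_relations_nonzero[OF min N] show False by blast
qed

text \<open>Reversing the summation pairs each product with the opposite one, and odd generators
  anticommute; thus twice the sum lies in the ideal.\<close>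

lemma quad_poly_same_odd:
  assumes "i \<in> verts Q" "odd (num_arrows Q i i)"
  shows "quad_poly i i k 0 \<in> supercomm_ideal (gens Q) (gen_par Q)"
proof -
  let ?I = "supercomm_ideal (gens Q) (gen_par Q)"
  have "quad_poly i i k 0 = (\<Sum>l\<le>k. gen (i, l) * gen (i, k - l))" by (simp add: quad_poly_def)
  moreover have "(\<Sum>l\<le>k. gen (i, l) * gen (i, k - l)) = (\<Sum>l\<le>k. gen (i, k - l) * gen (i, l))"
    by (rule sum.reindex_bij_witness[of _ "\<lambda>l. k - l" "\<lambda>l. k - l"]) auto
  ultimately have "quad_poly i i k 0 + quad_poly i i k 0
      = (\<Sum>l\<le>k. gen (i, l) * gen (i, k - l) + gen (i, k - l) * gen (i, l))"
    by (simp add: sum.distrib)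
  also have "\<dots> \<in> ?I"
  proof (rule supercomm_ideal_sum)
    fix l
    show "gen (i, l) * gen (i, k - l) + gen (i, k - l) * gen (i, l) \<in> ?I"
      using supercommutator_in[of "(i, l)" "gens Q" "(i, k - l)" "gen_par Q"] assms
      by (simp add: gens_def gen_par_def const_uminus)
  qed
  finally have "const (1/2) * (quad_poly i i k 0 + quad_poly i i k 0) \<in> ?I" by (rule supercomm_ideal_scale)
  then show ?thesis by (simp add: distrib_left flip: vs.scale_left_distrib)
qed

section \<open>The quiver with two vertices and two opposite arrows\<close>

context
  fixes Q :: "('v, 'e) pre_digraph" and u v :: 'v
  assumes uv: "u \<noteq> v" "verts Q = {u, v}"
    and arr: "num_arrows Q u u = 0" "num_arrows Q v v = 0" "num_arrows Q u v = 1" "num_arrows Q v u = 1"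
begin

abbreviation (input) "I2 \<equiv> supercomm_ideal (gens Q) (gen_par Q)"

definition side :: "'v \<times> nat \<Rightarrow> bool \<times> nat" where
  "side = (\<lambda>(i, k). (i = u, k))"

lemma side_bij: "bij_betw side (gens Q) UNIV"
proof (rule bij_betw_imageI)
  show "inj_on side (gens Q)" using uv by (auto simp: inj_on_def side_def gens_def)
  have "y \<in> side ` gens Q" for y
    using uv by (intro image_eqI[of _ _ "(if fst y then u else v, snd y)"]) (auto simp: side_def gens_def prod_eq_iff)
  then show "side ` gens Q = UNIV" by blast
qed

lemma par_zero: "x \<in> gens Q \<Longrightarrow> gen_par Q x = 0"
  using uv arr by (auto simp: gens_def gen_par_def)

lemma par_even: "x \<in> gens Q \<Longrightarrow> even (gen_par Q x)"
  by (simp add: par_zero)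

abbreviation ab :: "'v free_alg \<Rightarrow> (bool \<times> nat) mpoly" where
  "ab \<equiv> abel side"

lemma ab_ideal: "p \<in> I2 \<Longrightarrow> ab p = 0"
  by (rule abel_supercomm_ideal[OF par_even])

lemma ab_eq_imp: "p \<in> carrier (FA Q) \<Longrightarrow> q \<in> carrier (FA Q) \<Longrightarrow> ab p = ab q \<Longrightarrow> p - q \<in> I2"
  by (rule abel_eq_imp[OF par_even side_bij])

abbreviation (input) qp :: "nat \<Rightarrow> 'v free_alg" where
  "qp k \<equiv> quad_poly u v k 0"

lemma qp_closed: "qp k \<in> carrier (FA Q)"
  using quad_poly_long[of u Q v k 0] uv long_polys_carrier[of "gens Q"] by auto

lemma ab_sum: "ab (sum p A) = (\<Sum>i\<in>A. ab (p i))"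
  by (simp add: abel_def push_sum)

lemma ab_diff: "ab (p - q) = ab p - ab q"
  by (simp add: abel_def push_diff)

lemma side_simps: "side (u, l) = (True, l)" "side (v, l) = (False, l)"
  using uv(1) by (simp_all add: side_def)

lemma ab_qp: "ab (qp k) = conv 0 0 k"
  by (simp add: quad_poly_def ab_sum abel_mult abel_gen conv_def side_simps)

lemma ab_qp': "ab (quad_poly v u k 0) = conv 0 0 k"
proof -
  have "ab (quad_poly v u k 0) = (\<Sum>l\<le>k. var (False, l) * var (True, k - l))"
    by (simp add: quad_poly_def ab_sum abel_mult abel_gen side_simps)
  also have "\<dots> = conv 0 0 k"
    unfolding conv_def
    by (rule sum.reindex_bij_witness[of _ "\<lambda>l. k - l" "\<lambda>l. k - l"]) (auto simp: mult.commute)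
  finally show ?thesis .
qed

text \<open>Commutativity identifies the relations for \<open>(v, u)\<close> with those for
  \<open>(u, v)\<close>, and there are no loops to give others.\<close>

lemma cls_quad_polys: "cls Q ` quad_polys Q = cls Q ` range qp"
proof
  have "cls Q (quad_poly v u k 0) = cls Q (qp k)" for k
    using quad_poly_long[of v Q u k 0] uv long_polys_carrier[of "gens Q"] qp_closed ab_qp ab_qp'
    by (subst cls_eq_iff) (auto intro!: ab_eq_imp)
  then show "cls Q ` quad_polys Q \<subseteq> cls Q ` range qp"
    using uv arr by (auto simp: quad_polys_def)
  have "qp k \<in> quad_polys Q" for k
    unfolding quad_polys_def using uv arr by (intro CollectI exI[of _ u] exI[of _ v] exI[of _ k] exI[of _ 0]) simp
  then show "cls Q ` range qp \<subseteq> cls Q ` quad_polys Q" by blast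
qed

text \<open>The monomial \<open>a_0 b_l\<close> occurs in exactly one of the series coefficients, so
  it detects the scalar in front of it.\<close>

lemma lookup_conv: "Poly_Mapping.lookup (conv 0 0 k) {#(True, 0), (False, l)#} = (if k = l then 1 else 0)"
proof -
  have "Poly_Mapping.lookup (conv 0 0 k) {#(True, 0), (False, l)#}
    = (\<Sum>i\<le>k. if i = 0 then (if k = l then 1 else 0) else 0)"
    unfolding conv_def lookup_sum
    by (intro sum.cong) (auto simp: var_def mult_single lookup_single when_def add_eq_conv_diff)
  then show ?thesis by simp
qed

lemma snd_word_degree:
  assumes "set (letters w) \<subseteq> gens Q"
  shows "snd (word_degree Q w) = - 2 * int (\<Sum>x\<in>#mset (map side (letters w)). snd x)"
proof -
  have "snd (\<Sum>x\<leftarrow>xs. gen_degree Q x) = - 2 * int (\<Sum>x\<in>#mset (map side xs). snd x)"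
    if "set xs \<subseteq> gens Q" for xs
    using that uv arr by (induction xs) (auto simp: gen_degree_def side_def gens_def)
  then show ?thesis using assms by (simp add: word_degree_def)
qed

text \<open>Different indices \<open>k\<close> have different degrees \<open>- 2 * k\<close>, so a
  homogeneous combination has a single nonzero term.\<close>

lemma homogeneous_relation:
  assumes "homogeneous Q f" "f \<in> cls Q ` vs.span (range qp)" "f \<noteq> cls Q 0"
  shows "\<exists>k c. c \<noteq> 0 \<and> f = cls Q (const c * qp k)"
proof -
  from assms(2) obtain r where r: "f = cls Q r" "r \<in> vs.span (qp ` UNIV)" by blast
  from span_image_sum[OF r(2)] obtain n c where c: "r = (\<Sum>j<n. const (c j) * qp j)" by blast
  from assms(1) obtain p d where p: "p \<in> carrier (FA Q)" "f = cls Q p"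
    "\<And>w. w \<in> Poly_Mapping.keys p \<Longrightarrow> word_degree Q w = d"
    by (auto simp: homogeneous_def has_degree_def)
  have rc: "r \<in> carrier (FA Q)"
    unfolding c by (intro sum_closed mult_closed const_closed qp_closed)
  have "r - p \<in> I2" using cls_eq_iff[OF rc p(1)] r(1) p(2) by simp
  then have "ab r = ab p" using ab_ideal[of "r - p"] by (simp add: ab_diff)
  then have abp: "ab p = (\<Sum>j<n. Poly_Mapping.single 0 (c j) * conv 0 0 j)"
    by (simp add: c ab_sum abel_mult abel_const ab_qp)
  \<comment> \<open>The homogeneous representative \<open>p\<close> may differ from \<open>r\<close>
    by supercommutators, so the degree is read from a monomial of the common image under
    \<open>ab\<close>, lifted back to a word of \<open>p\<close>.\<close>
  have deg: "snd d = - 2 * int j" if "j < n" "c j \<noteq> 0" for j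
  proof -
    let ?m = "{#(True, 0), (False, j)#}"
    have "Poly_Mapping.lookup (ab p) ?m = (\<Sum>i<n. if i = j then c j else 0)"
      unfolding abp lookup_sum
      by (intro sum.cong refl)
         (simp add: lookup_conv Poly_Mapping.map.rep_eq when_def flip: mult_map_scale_conv_mult)
    with that have "?m \<in> Poly_Mapping.keys (ab p)" by (simp add: in_keys_iff)
    from subsetD[OF keys_push this[unfolded abel_def]]
    obtain w where w: "w \<in> Poly_Mapping.keys p" "?m = mset (map side (letters w))"
      by (elim imageE)
    have "set (letters w) \<subseteq> gens Q" using p(1) w(1) by (auto simp: carrier_free_algebra_iff)
    from snd_word_degree[OF this] show ?thesis using p(3)[OF w(1)] unfolding w(2)[symmetric] by simp
  qed
  have "r \<noteq> 0" using assms(3) r(1) by blast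
  then obtain k where "k \<in> {..<n}" "const (c k) * qp k \<noteq> 0"
    unfolding c by (rule sum.not_neutral_contains_not_neutral)
  then have k: "k < n" "c k \<noteq> 0" by auto
  have "c j = 0" if "j < n" "j \<noteq> k" for j using deg[OF k] deg[OF that(1)] that(2) by auto
  then have "r = (\<Sum>j<n. if j = k then const (c k) * qp k else 0)"
    unfolding c by (intro sum.cong) auto
  with k have "r = const (c k) * qp k" by simp
  with k r(1) show ?thesis by blast
qed

lemma minimal_relations_two_vertices:
  assumes min: "minimal_relations Q N f"
  obtains k c where "\<And>n. enat n < N \<Longrightarrow> c n \<noteq> 0" "\<And>n. enat n < N \<Longrightarrow> f n = cls Q (const (c n) * qp (k n))"
    "\<And>m n. enat n < N \<Longrightarrow> m < n \<Longrightarrow> k m \<noteq> k n"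
proof -
  obtain g where g: "\<And>n. enat n < N \<Longrightarrow> f n = cls Q (g n)" "\<And>n. enat n < N \<Longrightarrow> g n \<in> vs.span (quad_polys Q)"
    by (rule minimal_relations_reps[OF min]) blast
  have "cls Q ` vs.span (quad_polys Q) = cls Q ` vs.span (range qp)"
    using linear_span_cls[OF order_trans[OF quad_polys_long long_polys_carrier], of Q]
      linear_span_cls[of "range qp" Q] cls_quad_polys qp_closed by (metis image_subsetI)
  then have "\<exists>k c. c \<noteq> 0 \<and> f n = cls Q (const c * qp k)" if "enat n < N" for n
    using that g[OF that] minimal_relations_nonzero[OF min that] min
    by (intro homogeneous_relation) (auto simp: minimal_relations_def)
  then obtain k c where kc: "\<And>n. enat n < N \<Longrightarrow> c n \<noteq> 0 \<and> f n = cls Q (const (c n) * qp (k n))"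
    by metis
  have "k m \<noteq> k n" if n: "enat n < N" "m < n" for m n
  proof
    assume eq: "k m = k n"
    have N: "enat j < N" if "j \<le> n" for j using that n(1) by (meson enat_ord_simps(1) le_less_trans)
    let ?G = "\<lambda>j. const (c j) * qp (k j)"
    have map_f: "map f [Suc m..<Suc n] = map (cls Q) (map ?G [Suc m..<Suc n])"
      using kc N by auto
    have Span_f: "ring.Span (R\<^sub>Q Q) (scalars Q) (map (cls Q) (map ?G [Suc m..<Suc n]))
        = cls Q ` vs.span (set (map ?G [Suc m..<Suc n]))"
      by (rule Span_cls) (auto intro!: mult_closed const_closed qp_closed)
    have "?G m \<in> vs.span (set (map ?G [Suc m..<Suc n]))"
    proof -
      have "?G n \<in> set (map ?G [Suc m..<Suc n])" using n(2) by simp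
      then have "const (c m / c n) * ?G n \<in> vs.span (set (map ?G [Suc m..<Suc n]))"
        by (intro vs.span_scale vs.span_base)
      then show ?thesis using kc[OF n(1)] by (simp add: eq flip: mult.assoc const_mult)
    qed
    moreover have "f m = cls Q (?G m)" using kc[OF N] n(2) by simp
    ultimately have "f m \<in> ring.Span (R\<^sub>Q Q) (scalars Q) (map f [Suc m..<Suc n])"
      unfolding map_f Span_f by blast
    with minimal_relations_not_in_Span[OF min n(1), of m] n(2) show False by simp
  qed
  with kc that show thesis by blast
qed

lemma regular_two_vertices:
  assumes min: "minimal_relations Q N f"
  shows "regular_sequence Q N f"
  unfolding regular_sequence_def
proof (intro allI impI)
  fix n assume n: "enat n < N"
  obtain k c where c: "\<And>n. enat n < N \<Longrightarrow> c n \<noteq> 0" and f: "\<And>n. enat n < N \<Longrightarrow> f n = cls Q (const (c n) * qp (k n))"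
    and k: "\<And>m n. enat n < N \<Longrightarrow> m < n \<Longrightarrow> k m \<noteq> k n"
    using minimal_relations_two_vertices[OF min] by metis
  have N: "enat j < N" if "j \<le> n" for j using that n by (meson enat_ord_simps(1) le_less_trans)
  interpret RQ: ring "R\<^sub>Q Q" by (rule ring_free_supercomm_algebra)
  let ?J = "Idl\<^bsub>R\<^sub>Q Q\<^esub> (f ` {..<n})"
  let ?S = "conv 0 0 ` k ` {..<n}"
  have G: "const (c j) * qp (k j) \<in> carrier (FA Q)" for j
    by (intro mult_closed const_closed qp_closed)
  have sub: "f ` {..<n} \<subseteq> carrier (R\<^sub>Q Q)" using f N G by (auto simp: cls_in)
  have J: "ideal ?J (R\<^sub>Q Q)" by (rule RQ.genideal_ideal[OF sub])
  interpret J: ideal ?J "R\<^sub>Q Q" by fact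
  note sp = subspace_ideal[OF ideal_cls_preimage[OF J]]
  \<comment> \<open>Together \<open>fwd\<close> and \<open>bwd\<close> show that membership in the
    ideal of the earlier relations can be tested on images under \<open>ab\<close>.\<close>
  have fwd: "ab q \<in> idl.span ?S" if q: "q \<in> carrier (FA Q)" "cls Q q \<in> ?J" for q
  proof -
    let ?K = "{q \<in> carrier (FA Q). ab q \<in> idl.span ?S}"
    have "const (c j) * qp (k j) \<in> ?K" if "j < n" for j
    proof -
      have "Poly_Mapping.single 0 (c j) * conv 0 0 (k j) \<in> idl.span ?S"
        using that by (intro idl.span_scale idl.span_base) simp
      with G show ?thesis by (simp add: abel_mult ab_qp abel_const)
    qed
    then have "f ` {..<n} \<subseteq> cls Q ` ?K" using f N by auto
    then have "?J \<subseteq> cls Q ` ?K"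
      by (intro RQ.genideal_minimal ideal_cls_image ideal_abel_preimage)
    with q(2) obtain q' where q': "cls Q q = cls Q q'" "q' \<in> ?K" by blast
    then have "q - q' \<in> I2" using cls_eq_iff q(1) by blast
    then have "ab q = ab q'" using ab_ideal[of "q - q'"] by (simp add: ab_diff)
    with q'(2) show ?thesis by simp
  qed
  have bwd: "cls Q q \<in> ?J" if q: "q \<in> carrier (FA Q)" "ab q \<in> idl.span ?S" for q
  proof -
    have "\<exists>q \<in> {q \<in> carrier (FA Q). cls Q q \<in> ?J}. ab q = y" if "y \<in> idl.span ?S" for y
      using that
    proof (induction rule: idl.span_induct_alt)
      case base
      show ?case using vs.subspace_0[OF sp] by (intro bexI[of _ 0]) (simp_all add: abel_0)
    next
      case (step a x y)
      then obtain j q where j: "j < n" "x = conv 0 0 (k j)"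
        and q: "q \<in> {q \<in> carrier (FA Q). cls Q q \<in> ?J}" "ab q = y" by blast
      \<comment> \<open>Surjectivity of \<open>ab\<close>, through \<open>unabel\<close>, lifts the
        coefficient \<open>a\<close>.\<close>
      obtain b where b: "b \<in> carrier (FA Q)" "ab b = a"
        by (rule that[OF unabel_closed[OF par_even side_bij] abel_unabel[OF par_even side_bij]])
      have "f j \<in> ?J" using RQ.genideal_self[OF sub] j(1) by auto
      then have "const (c j) * qp (k j) \<in> {q \<in> carrier (FA Q). cls Q q \<in> ?J}"
        using f[OF N] j(1) G by simp
      then have "const (1 / c j) * (const (c j) * qp (k j)) \<in> {q \<in> carrier (FA Q). cls Q q \<in> ?J}"
        by (rule vs.subspace_scale[OF sp])
      then have "qp (k j) \<in> {q \<in> carrier (FA Q). cls Q q \<in> ?J}"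
        using c[OF N] j(1) by (simp flip: mult.assoc const_mult)
      then have "b * qp (k j) \<in> {q \<in> carrier (FA Q). cls Q q \<in> ?J}"
        using ideal.I_l_closed[OF ideal_cls_preimage[OF J] _ b(1)] by (simp add: free_algebra_ops)
      from vs.subspace_add[OF sp this q(1)] show ?case
        by (intro bexI[of _ "b * qp (k j) + q"]) (simp_all add: abel_add abel_mult ab_qp b(2) q(2) j(2))
    qed
    then obtain q' where q': "q' \<in> carrier (FA Q)" "cls Q q' \<in> ?J" "ab q' = ab q" using q(2) by blast
    have "cls Q q = cls Q q'" using cls_eq_iff[OF q(1) q'(1)] ab_eq_imp[OF q(1) q'(1)] q'(3) by simp
    with q'(2) show ?thesis by simp
  qed
  \<comment> \<open>The indices are distinct, so this is the last condition in \<open>regseq\<close>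
    for the first \<open>Suc n\<close> of them.\<close>
  have reg: "g \<in> idl.span ?S" if "conv 0 0 (k n) * g \<in> idl.span ?S" for g
  proof -
    have inj: "inj_on k {0..<Suc n}"
    proof (rule inj_onI, rule ccontr)
      fix i j assume ij: "i \<in> {0..<Suc n}" "j \<in> {0..<Suc n}" "k i = k j" "i \<noteq> j"
      then show False using k[of j i] k[of i j] N[of i] N[of j] by (cases i j rule: linorder_cases) auto
    qed
    have "regseq {} (map (conv 0 0) (map k [0..<Suc n]))"
      using regseq_conv[of "map k [0..<Suc n]" 0 0] inj
      by (simp add: first_vars_def distinct_map del: upt_Suc)
    then have "regseq {} (map (conv 0 0) (map k [0..<n]) @ [conv 0 0 (k n)])" by simp
    then have "\<forall>g. conv 0 0 (k n) * g \<in> idl.span ?S \<longrightarrow> g \<in> idl.span ?S"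
      unfolding regseq_append by (simp add: atLeast0LessThan image_image)
    with that show ?thesis by blast
  qed
  have fn: "f n \<in> carrier (R\<^sub>Q Q)" using f[OF n] G by (simp add: cls_in)
  have "homogeneous Q (f n)" using min n by (auto simp: minimal_relations_def)
  moreover have "inj_on (\<lambda>x. f n \<odot>\<^bsub>quotient_module (R\<^sub>Q Q) ?J\<^esub> x) (carrier (quotient_module (R\<^sub>Q Q) ?J))"
    unfolding J.inj_on_quotient_module_iff[OF fn]
  proof (intro ballI impI)
    fix x assume x: "x \<in> carrier (R\<^sub>Q Q)" "f n \<otimes>\<^bsub>R\<^sub>Q Q\<^esub> x \<in> ?J"
    then obtain q where q: "q \<in> carrier (FA Q)" "x = cls Q q" by (auto simp: carrier_RQ)
    have "cls Q (const (c n) * qp (k n) * q) \<in> ?J"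
      using x(2) f[OF n] G q by (simp add: cls_mult)
    from fwd[OF mult_closed[OF G q(1)] this]
    have "Poly_Mapping.single 0 (c n) * (conv 0 0 (k n) * ab q) \<in> idl.span ?S"
      by (simp add: abel_mult abel_const ab_qp mult.assoc)
    from idl.span_scale[OF this, of "Poly_Mapping.single 0 (1 / c n)"]
    have "Poly_Mapping.single 0 (1 / c n) * Poly_Mapping.single 0 (c n) * (conv 0 0 (k n) * ab q) \<in> idl.span ?S"
      by (subst mult.assoc)
    moreover have "Poly_Mapping.single 0 (1 / c n) * Poly_Mapping.single 0 (c n) = (1 :: (bool \<times> nat) mpoly)"
      unfolding mult_single using c[OF n] by simp
    ultimately have "conv 0 0 (k n) * ab q \<in> idl.span ?S" by (simp only: mult_1_left)
    then show "x \<in> ?J" unfolding q(2) by (rule bwd[OF q(1) reg])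
  qed
  \<comment> \<open>The odd clause of \<open>regular_on\<close> is vacuous: all words are even and
    \<open>f n\<close> is nonzero.\<close>
  moreover have "\<not> has_parity Q 1 (f n)"
  proof
    assume "has_parity Q 1 (f n)"
    then obtain p where p: "p \<in> carrier (FA Q)" "f n = cls Q p" "\<And>w. w \<in> Poly_Mapping.keys p \<Longrightarrow> word_par Q w = 1"
      by (auto simp: has_parity_def)
    have "word_par Q w = 0" if "w \<in> Poly_Mapping.keys p" for w
    proof -
      have "(\<Sum>x\<leftarrow>letters w. gen_par Q x) = 0"
        using that p(1) par_zero by (subst sum_list_eq_0_iff) (auto simp: carrier_free_algebra_iff)
      then show ?thesis unfolding word_par_def by (simp only: mod_0)
    qed
    with p(3) have "Poly_Mapping.keys p = {}" by fastforce
    then show False using p(2) minimal_relations_nonzero[OF min n] by simp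
  qed
  ultimately show "regular_on Q (quotient_module (R\<^sub>Q Q) ?J) (f n)"
    by (simp add: regular_on_def)
qed

end

theorem proposition6p13:
  fixes Q :: "('v, 'e) pre_digraph"
    and N :: enat and f :: "nat \<Rightarrow> 'v free_alg set"
  assumes "fin_digraph Q"
    and "Digraph_Component.connected Q"
    and "symmetric_quiver Q"
    and "minimal_relations Q N f"
  shows "regular_sequence Q N f \<longleftrightarrow>
      (\<exists>u. verts Q = {u} \<and> arcs Q = {})
    \<or> (\<exists>u e. verts Q = {u} \<and> arcs Q = {e})
    \<or> (\<exists>u v e e'. u \<noteq> v \<and> e \<noteq> e' \<and> verts Q = {u, v} \<and> arcs Q = {e, e'} \<and>
         tail Q e = u \<and> head Q e = v \<and> tail Q e' = v \<and> head Q e' = u)"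
    (is "_ \<longleftrightarrow> ?A \<or> ?B \<or> ?C")
proof
  assume "regular_sequence Q N f"
  with assms show "?A \<or> ?B \<or> ?C" by (rule regular_imp_small_quiver)
next
  interpret fin_digraph Q by fact
  assume "?A \<or> ?B \<or> ?C"
  then consider ?A | ?B | ?C by blast
  then show "regular_sequence Q N f"
  proof cases
    case 1
    then have "quad_polys Q = {}" by (auto simp: quad_polys_def num_arrows_def)
    then have "N = 0" using minimal_relations_trivial[OF assms(4)] by blast
    then show ?thesis by (simp add: regular_sequence_def)
  next
    case 2
    then obtain u e where ue: "verts Q = {u}" "arcs Q = {e}" by blast
    then have "tail Q e = u" "head Q e = u" using wellformed by auto
    then have "{a \<in> arcs Q. tail Q a = u \<and> head Q a = u} = {e}" using ue by auto
    then have m: "num_arrows Q u u = 1" by (simp add: num_arrows_def)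
    \<comment> \<open>A single loop makes the generators odd and allows only \<open>p = 0\<close>,
      so every relation vanishes in R and the basis is empty.\<close>
    then have "quad_polys Q \<subseteq> supercomm_ideal (gens Q) (gen_par Q)"
      using ue(1) quad_poly_same_odd[of u Q] by (auto simp: quad_polys_def)
    then have "N = 0" by (rule minimal_relations_trivial[OF assms(4)])
    then show ?thesis by (simp add: regular_sequence_def)
  next
    case 3
    then obtain u v e e' where uv: "u \<noteq> v" "e \<noteq> e'" "verts Q = {u, v}" "arcs Q = {e, e'}"
      "tail Q e = u" "head Q e = v" "tail Q e' = v" "head Q e' = u" by blast
    then have "{a \<in> arcs Q. tail Q a = u \<and> head Q a = u} = {}" "{a \<in> arcs Q. tail Q a = v \<and> head Q a = v} = {}"
      "{a \<in> arcs Q. tail Q a = u \<and> head Q a = v} = {e}" "{a \<in> arcs Q. tail Q a = v \<and> head Q a = u} = {e'}"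
      by auto
    then have "num_arrows Q u u = 0" "num_arrows Q v v = 0" "num_arrows Q u v = 1" "num_arrows Q v u = 1"
      by (simp_all add: num_arrows_def)
    from regular_two_vertices[OF uv(1,3) this assms(4)] show ?thesis .
  qed
qed

end
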